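(* Let $(M,h,\nabla)$ be a quasi-statistical manifold such that $\nabla$ is flat. Let $h^H$ be the horizontal lift of $h$ to $TM$ with respect to $\nabla$ and let $\tilde{\tilde\nabla}$ be the affine connection on $TM$ determined by $$\tilde{\tilde\nabla}_{X^H}Y^H=(\nabla_XY)^H,\quad \tilde{\tilde\nabla}_{X^H}Y^V=(\nabla_XY)^V,\quad \tilde{\tilde\nabla}_{X^V}Y^H=0,\quad \tilde{\tilde\nabla}_{X^V}Y^V=0$$ for all vector fields $X,Y$ on $M$. Then $(TM,h^H,\tilde{\tilde\nabla})$ is a quasi-statistical manifold if and only if $\nabla h=0$.
   Context: A quasi-statistical manifold $(N,k,D)$ is a smooth manifold $N$ with a non-degenerate $(0,2)$-tensor field $k$ (not necessarily symmetric) and an affine connection $D$ (possibly with torsion $T^D(A,B)=D_AB-D_BA-[A,B]$) such that $(D_Ak)(B,C)-(D_Bk)(A,C)+k(T^D(A,B),C)=0$ for all vector fields $A,B,C$ on $N$. A connection is flat if its curvature vanishes (torsion is allowed). With coordinates $(\tilde x^i,y^i)$ on $TM$ induced by coordinates $(x^i)$ on $M$ and $\nabla_{\partial/\partial x^i}\partial/\partial x^j=\Gamma^k_{ij}\partial/\partial x^k$, the horizontal lift of $X=X^i\partial/\partial x^i$ is $X^H=X^i\big(\partial/\partial\tilde x^i-y^k\Gamma^l_{ik}\,\partial/\partial y^l\big)$ and its vertical lift is $X^V=X^i\partial/\partial y^i$. The horizontal lift $h^H$ is the $(0,2)$-tensor field on $TM$ with $h^H(X^H,Y^H)=0$, $h^H(X^V,Y^V)=0$,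 $h^H(X^H,Y^V)=h(X,Y)$ and $h^H(X^V,Y^H)=h(X,Y)$ for vector fields $X,Y$ on $M$. *)

theory Defs
  imports "HOL-Analysis.Analysis" "HOL-Library.Function_Algebras"
begin

section \<open>Smooth maps between Euclidean spaces\<close>

text \<open>
  \<open>C\<^sup>k\<close> and smooth maps on an open set: \<open>f\<close> is \<open>C\<^sup>k\<^sup>+\<^sup>1\<close> iff it is differentiable and all
  its directional derivatives are \<open>C\<^sup>k\<close>.
\<close>

primrec Ck_on :: "nat \<Rightarrow> 'a::euclidean_space set \<Rightarrow> ('a \<Rightarrow> 'b::real_normed_vector) \<Rightarrow> bool" where
  "Ck_on 0 S f \<longleftrightarrow> continuous_on S f"
| "Ck_on (Suc k) S f \<longleftrightarrow>
     (\<forall>x\<in>S. f differentiable (at x)) \<and>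
     (\<forall>v. Ck_on k S (\<lambda>x. frechet_derivative f (at x) v))"

definition smooth_on :: "'a::euclidean_space set \<Rightarrow> ('a \<Rightarrow> 'b::real_normed_vector) \<Rightarrow> bool" where
  "smooth_on S f \<longleftrightarrow> (\<forall>k. Ck_on k S f)"


section \<open>Smooth manifolds\<close>

text \<open>
  A manifold is given by a (not necessarily maximal) smooth atlas, indexed by the type \<open>'i\<close>.
  Charts may have empty domain, so every atlas can be indexed by any type that is large enough;
  \<open>'b\<close> is the Euclidean model space.  The values of \<open>chart_map M i\<close> outside \<open>chart_dom M i\<close>
  are irrelevant.  The underlying set is the union of the chart domains, and the topology is
  the one for which all charts are homeomorphisms from open sets onto open sets.
\<close>

record ('a, 'i, 'b) atlas =
  chart_dom :: "'i \<Rightarrow> 'a set"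
  chart_map :: "'i \<Rightarrow> 'a \<Rightarrow> 'b"

definition points :: "('a, 'i, 'b) atlas \<Rightarrow> 'a set" where
  "points M = (\<Union>i. chart_dom M i)"

definition chart_img :: "('a, 'i, 'b) atlas \<Rightarrow> 'i \<Rightarrow> 'b set" where
  "chart_img M i = chart_map M i ` chart_dom M i"

definition chart_inv :: "('a, 'i, 'b) atlas \<Rightarrow> 'i \<Rightarrow> 'b \<Rightarrow> 'a" where
  "chart_inv M i = inv_into (chart_dom M i) (chart_map M i)"

definition transition :: "('a, 'i, 'b) atlas \<Rightarrow> 'i \<Rightarrow> 'i \<Rightarrow> 'b \<Rightarrow> 'b" where
  "transition M i j = chart_map M j \<circ> chart_inv M i"

definition manifold_topology :: "('a, 'i, 'b::euclidean_space) atlas \<Rightarrow> 'a topology" where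
  "manifold_topology M =
     topology (\<lambda>U. U \<subseteq> points M \<and> (\<forall>i. open (chart_map M i ` (U \<inter> chart_dom M i))))"

definition smooth_manifold :: "('a, 'i, 'b::euclidean_space) atlas \<Rightarrow> bool" where
  "smooth_manifold M \<longleftrightarrow>
     (\<forall>i. inj_on (chart_map M i) (chart_dom M i) \<and> open (chart_img M i)) \<and>
     (\<forall>i j. open (chart_map M i ` (chart_dom M i \<inter> chart_dom M j)) \<and>
        smooth_on (chart_map M i ` (chart_dom M i \<inter> chart_dom M j)) (transition M i j)) \<and>
     Hausdorff_space (manifold_topology M) \<and>
     second_countable (manifold_topology M)"

definition smooth_fun :: "('a, 'i, 'b::euclidean_space) atlas \<Rightarrow> ('a \<Rightarrow> real) \<Rightarrow> bool" where
  "smooth_fun M f \<longleftrightarrow> (\<forall>i. smooth_on (chart_img M i) (f \<circ> chart_inv M i))"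


section \<open>Tangent vectors and vector fields\<close>

text \<open>
  A tangent vector at \<open>p\<close> is the family \<open>v\<close> of its component vectors \<open>v i\<close> with respect to the
  charts \<open>i\<close> around \<open>p\<close>, which transforms by the derivatives of the transition maps.  By
  convention \<open>v i = 0\<close> for the charts \<open>i\<close> not containing \<open>p\<close>; hence tangent vectors are equal iff
  they are equal as functions, and the tangent space at a non-point is \<open>{0}\<close>.
\<close>

definition tangent_space :: "('a, 'i, 'b::euclidean_space) atlas \<Rightarrow> 'a \<Rightarrow> ('i \<Rightarrow> 'b) set" where
  "tangent_space M p =
     {v. (\<forall>i j. p \<in> chart_dom M i \<longrightarrow> p \<in> chart_dom M j \<longrightarrow>
            v j = frechet_derivative (transition M i j) (at (chart_map M i p)) (v i)) \<and>
         (\<forall>i. p \<notin> chart_dom M i \<longrightarrow> v i = 0)}"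

type_synonym ('a, 'i, 'b) vfield = "'a \<Rightarrow> 'i \<Rightarrow> 'b"

definition vector_field ::
  "('a, 'i, 'b::euclidean_space) atlas \<Rightarrow> ('a, 'i, 'b) vfield \<Rightarrow> bool" where
  "vector_field M X \<longleftrightarrow>
     (\<forall>p. X p \<in> tangent_space M p) \<and>
     (\<forall>i. smooth_on (chart_img M i) (\<lambda>x. X (chart_inv M i x) i))"

definition fscale :: "('a \<Rightarrow> real) \<Rightarrow> ('a, 'i, 'b::real_vector) vfield \<Rightarrow> ('a, 'i, 'b) vfield" where
  "fscale f X = (\<lambda>p i. f p *\<^sub>R X p i)"

text \<open>The function \<open>X f\<close>; for smooth \<open>f\<close> it does not depend on the chosen chart around \<open>p\<close>.\<close>

definition vf_apply ::
  "('a, 'i, 'b::euclidean_space) atlas \<Rightarrow> ('a, 'i, 'b) vfield \<Rightarrow> ('a \<Rightarrow> real) \<Rightarrow> 'a \<Rightarrow> real" where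
  "vf_apply M X f p =
     (let i = (SOME i. p \<in> chart_dom M i)
      in frechet_derivative (f \<circ> chart_inv M i) (at (chart_map M i p)) (X p i))"

text \<open>In coordinates, \<open>[X, Y] = (X\<^sup>j \<partial>\<^sub>j Y\<^sup>i - Y\<^sup>j \<partial>\<^sub>j X\<^sup>i) \<partial>\<^sub>i\<close>.\<close>

definition lie_bracket ::
  "('a, 'i, 'b::euclidean_space) atlas \<Rightarrow>
   ('a, 'i, 'b) vfield \<Rightarrow> ('a, 'i, 'b) vfield \<Rightarrow> ('a, 'i, 'b) vfield" where
  "lie_bracket M X Y = (\<lambda>p i. if p \<in> chart_dom M i
     then frechet_derivative (\<lambda>x. Y (chart_inv M i x) i) (at (chart_map M i p)) (X p i)
        - frechet_derivative (\<lambda>x. X (chart_inv M i x) i) (at (chart_map M i p)) (Y p i)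
     else 0)"


section \<open>Affine connections\<close>

type_synonym ('a, 'i, 'b) conn =
  "('a, 'i, 'b) vfield \<Rightarrow> ('a, 'i, 'b) vfield \<Rightarrow> ('a, 'i, 'b) vfield"

definition affine_connection ::
  "('a, 'i, 'b::euclidean_space) atlas \<Rightarrow> ('a, 'i, 'b) conn \<Rightarrow> bool" where
  "affine_connection M D \<longleftrightarrow>
     (\<forall>X Y. vector_field M X \<longrightarrow> vector_field M Y \<longrightarrow> vector_field M (D X Y)) \<and>
     (\<forall>X X' Y. vector_field M X \<longrightarrow> vector_field M X' \<longrightarrow> vector_field M Y \<longrightarrow>
        D (X + X') Y = D X Y + D X' Y) \<and>
     (\<forall>f X Y. smooth_fun M f \<longrightarrow> vector_field M X \<longrightarrow> vector_field M Y \<longrightarrow>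
        D (fscale f X) Y = fscale f (D X Y)) \<and>
     (\<forall>X Y Y'. vector_field M X \<longrightarrow> vector_field M Y \<longrightarrow> vector_field M Y' \<longrightarrow>
        D X (Y + Y') = D X Y + D X Y') \<and>
     (\<forall>f X Y. smooth_fun M f \<longrightarrow> vector_field M X \<longrightarrow> vector_field M Y \<longrightarrow>
        D X (fscale f Y) = fscale f (D X Y) + fscale (vf_apply M X f) Y)"

definition torsion ::
  "('a, 'i, 'b::euclidean_space) atlas \<Rightarrow> ('a, 'i, 'b) conn \<Rightarrow>
   ('a, 'i, 'b) vfield \<Rightarrow> ('a, 'i, 'b) vfield \<Rightarrow> ('a, 'i, 'b) vfield" where
  "torsion M D X Y = D X Y - D Y X - lie_bracket M X Y"

definition curvature ::
  "('a, 'i, 'b::euclidean_space) atlas \<Rightarrow> ('a, 'i, 'b) conn \<Rightarrow>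
   ('a, 'i, 'b) vfield \<Rightarrow> ('a, 'i, 'b) vfield \<Rightarrow> ('a, 'i, 'b) vfield \<Rightarrow> ('a, 'i, 'b) vfield" where
  "curvature M D X Y Z = D X (D Y Z) - D Y (D X Z) - D (lie_bracket M X Y) Z"

definition flat_connection ::
  "('a, 'i, 'b::euclidean_space) atlas \<Rightarrow> ('a, 'i, 'b) conn \<Rightarrow> bool" where
  "flat_connection M D \<longleftrightarrow>
     (\<forall>X Y Z. vector_field M X \<longrightarrow> vector_field M Y \<longrightarrow> vector_field M Z \<longrightarrow>
        curvature M D X Y Z = 0)"


section \<open>Tensor fields of type (0,2)\<close>

text \<open>
  \<open>k p\<close> is a bilinear form on the tangent space at \<open>p\<close>; its values on other arguments are
  irrelevant.
\<close>

type_synonym ('a, 'i, 'b) tensor02 = "'a \<Rightarrow> ('i \<Rightarrow> 'b) \<Rightarrow> ('i \<Rightarrow> 'b) \<Rightarrow> real"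

definition tensor_field02 ::
  "('a, 'i, 'b::euclidean_space) atlas \<Rightarrow> ('a, 'i, 'b) tensor02 \<Rightarrow> bool" where
  "tensor_field02 M k \<longleftrightarrow>
     (\<forall>p\<in>points M. \<forall>u\<in>tangent_space M p. \<forall>v\<in>tangent_space M p. \<forall>w\<in>tangent_space M p. \<forall>r.
        k p (u + v) w = k p u w + k p v w \<and>
        k p w (u + v) = k p w u + k p w v \<and>
        k p (\<lambda>i. r *\<^sub>R u i) w = r * k p u w \<and>
        k p w (\<lambda>i. r *\<^sub>R u i) = r * k p w u) \<and>
     (\<forall>X Y. vector_field M X \<longrightarrow> vector_field M Y \<longrightarrow> smooth_fun M (\<lambda>p. k p (X p) (Y p)))"

text \<open>
  Since \<open>k\<close> need not be symmetric, both kernels are required to be trivial; in finite dimension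
  each of the two conditions implies the other.
\<close>

definition nondegenerate02 ::
  "('a, 'i, 'b::euclidean_space) atlas \<Rightarrow> ('a, 'i, 'b) tensor02 \<Rightarrow> bool" where
  "nondegenerate02 M k \<longleftrightarrow>
     (\<forall>p\<in>points M. \<forall>v\<in>tangent_space M p.
        ((\<forall>w\<in>tangent_space M p. k p v w = 0) \<longrightarrow> v = 0) \<and>
        ((\<forall>w\<in>tangent_space M p. k p w v = 0) \<longrightarrow> v = 0))"

definition cov_deriv02 ::
  "('a, 'i, 'b::euclidean_space) atlas \<Rightarrow> ('a, 'i, 'b) conn \<Rightarrow> ('a, 'i, 'b) tensor02 \<Rightarrow>
   ('a, 'i, 'b) vfield \<Rightarrow> ('a, 'i, 'b) vfield \<Rightarrow> ('a, 'i, 'b) vfield \<Rightarrow> 'a \<Rightarrow> real" where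
  "cov_deriv02 M D k A B C p =
     vf_apply M A (\<lambda>q. k q (B q) (C q)) p - k p (D A B p) (C p) - k p (B p) (D A C p)"

definition parallel02 ::
  "('a, 'i, 'b::euclidean_space) atlas \<Rightarrow> ('a, 'i, 'b) conn \<Rightarrow> ('a, 'i, 'b) tensor02 \<Rightarrow> bool" where
  "parallel02 M D k \<longleftrightarrow>
     (\<forall>A B C. vector_field M A \<longrightarrow> vector_field M B \<longrightarrow> vector_field M C \<longrightarrow>
        (\<forall>p\<in>points M. cov_deriv02 M D k A B C p = 0))"

definition quasi_statistical_manifold ::
  "('a, 'i, 'b::euclidean_space) atlas \<Rightarrow> ('a, 'i, 'b) tensor02 \<Rightarrow> ('a, 'i, 'b) conn \<Rightarrow> bool" where
  "quasi_statistical_manifold N k D \<longleftrightarrow>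
     smooth_manifold N \<and> tensor_field02 N k \<and> nondegenerate02 N k \<and> affine_connection N D \<and>
     (\<forall>A B C. vector_field N A \<longrightarrow> vector_field N B \<longrightarrow> vector_field N C \<longrightarrow>
        (\<forall>p\<in>points N.
           cov_deriv02 N D k A B C p - cov_deriv02 N D k B A C p
             + k p (torsion N D A B p) (C p) = 0))"


section \<open>The tangent bundle and lifts\<close>

text \<open>
  Every chart \<open>i\<close> of \<open>M\<close> induces the chart of the tangent bundle \<open>TM\<close>, again with index \<open>i\<close>,
  whose coordinates at \<open>(p, v)\<close> are the coordinates of \<open>p\<close> and the components of \<open>v\<close>.
\<close>

definition tangent_bundle ::
  "('a, 'i, 'b::euclidean_space) atlas \<Rightarrow> ('a \<times> ('i \<Rightarrow> 'b), 'i, 'b \<times> 'b) atlas" where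
  "tangent_bundle M =
     \<lparr>chart_dom = (\<lambda>i. {(p, v). p \<in> chart_dom M i \<and> v \<in> tangent_space M p}),
      chart_map = (\<lambda>i (p, v). (chart_map M i p, v i))\<rparr>"

text \<open>
  Connections act on globally defined vector fields, while the coordinate fields of a chart are
  only defined on its domain.  Therefore \<open>\<nabla>\<^bsub>\<partial>\<^sub>a\<^esub> \<partial>\<^sub>b\<close> at \<open>p\<close> is evaluated on global fields that coincide
  with \<open>\<partial>\<^sub>a\<close> and \<open>\<partial>\<^sub>b\<close> near \<open>p\<close>; here \<open>a\<close> and \<open>b\<close> are vectors of the standard basis of the model
  space.  The value does not depend on the extensions.
\<close>

definition extends_coord_field ::
  "('a, 'i, 'b::euclidean_space) atlas \<Rightarrow> 'i \<Rightarrow> 'a \<Rightarrow> 'b \<Rightarrow> ('a, 'i, 'b) vfield \<Rightarrow> bool" where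
  "extends_coord_field M i p a X \<longleftrightarrow> vector_field M X \<and>
     (\<exists>U. openin (manifold_topology M) U \<and> p \<in> U \<and> U \<subseteq> chart_dom M i \<and> (\<forall>q\<in>U. X q i = a))"

definition christoffel ::
  "('a, 'i, 'b::euclidean_space) atlas \<Rightarrow> ('a, 'i, 'b) conn \<Rightarrow> 'i \<Rightarrow> 'a \<Rightarrow> 'b \<Rightarrow> 'b \<Rightarrow> 'b" where
  "christoffel M D i p a b =
     (THE w. \<forall>X Y. extends_coord_field M i p a X \<longrightarrow> extends_coord_field M i p b Y \<longrightarrow>
               D X Y p i = w)"

definition vertical_lift ::
  "('a, 'i, 'b::euclidean_space) atlas \<Rightarrow> ('a, 'i, 'b) vfield \<Rightarrow>
   ('a \<times> ('i \<Rightarrow> 'b), 'i, 'b \<times> 'b) vfield" where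
  "vertical_lift M X = (\<lambda>u i. if u \<in> chart_dom (tangent_bundle M) i
     then (0, X (fst u) i) else 0)"

definition horizontal_lift ::
  "('a, 'i, 'b::euclidean_space) atlas \<Rightarrow> ('a, 'i, 'b) conn \<Rightarrow> ('a, 'i, 'b) vfield \<Rightarrow>
   ('a \<times> ('i \<Rightarrow> 'b), 'i, 'b \<times> 'b) vfield" where
  "horizontal_lift M D X = (\<lambda>u i. if u \<in> chart_dom (tangent_bundle M) i
     then (X (fst u) i,
           - (\<Sum>a\<in>Basis. \<Sum>b\<in>Basis.
                ((X (fst u) i \<bullet> a) * (snd u i \<bullet> b)) *\<^sub>R christoffel M D i (fst u) a b))
     else 0)"

definition horizontal_lift02 ::
  "('a, 'i, 'b::euclidean_space) atlas \<Rightarrow> ('a, 'i, 'b) conn \<Rightarrow> ('a, 'i, 'b) tensor02 \<Rightarrow>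
   ('a \<times> ('i \<Rightarrow> 'b), 'i, 'b \<times> 'b) tensor02 \<Rightarrow> bool" where
  "horizontal_lift02 M D h hH \<longleftrightarrow>
     tensor_field02 (tangent_bundle M) hH \<and>
     (\<forall>X Y. vector_field M X \<longrightarrow> vector_field M Y \<longrightarrow>
        (\<forall>u\<in>points (tangent_bundle M).
           hH u (horizontal_lift M D X u) (horizontal_lift M D Y u) = 0 \<and>
           hH u (vertical_lift M X u) (vertical_lift M Y u) = 0 \<and>
           hH u (horizontal_lift M D X u) (vertical_lift M Y u) = h (fst u) (X (fst u)) (Y (fst u)) \<and>
           hH u (vertical_lift M X u) (horizontal_lift M D Y u) = h (fst u) (X (fst u)) (Y (fst u))))"

end

theory Submission
  imports Defs
begin

text \<open>
  The torsion cancels two terms, so the quasi-statistical condition for \<open>(N, k, D)\<close> says that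
  \<open>A k(B,C) - B k(A,C) - k(B, D\<^sub>A C) + k(A, D\<^sub>B C) - k([A,B], C)\<close> vanishes.  This expression is
  tensorial in \<open>A, B, C\<close>, and every tangent vector of \<open>TM\<close> is the value of some \<open>X\<^sup>H + Y\<^sup>V\<close>, so on
  \<open>TM\<close> it suffices to evaluate it on lifts.  The brackets of lifts are \<open>[X\<^sup>V, Y\<^sup>V] = 0\<close>,
  \<open>[X\<^sup>H, Y\<^sup>V] = (\<nabla>\<^sub>X Y)\<^sup>V\<close> and, by flatness, \<open>[X\<^sup>H, Y\<^sup>H] = [X, Y]\<^sup>H\<close>.  The only value that does not
  vanish identically or by the condition on \<open>M\<close> is \<open>(\<nabla>\<^sub>X h)(Y, Z)\<close>, taken on \<open>(X\<^sup>H, Y\<^sup>V, Z\<^sup>H)\<close>.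
\<close>

section \<open>Calculus of smooth maps\<close>

text \<open>Connections act on global vector fields only, so pointwise arguments need cut-off
  fields: bump functions give global fields that are constant in a chart near a given point, and the
  Hausdorff property makes their extension by zero smooth. Hence an expression that is linear over
  smooth functions depends on its argument at one point only, and the Christoffel symbols are well
  defined. Their inhomogeneous change of charts cancels the second derivatives of the transition
  maps that appear in the transition maps of \<open>TM\<close>; this is why horizontal lifts are
  vector fields. At a point (p, w) of \<open>TM\<close> the bracket of two horizontal lifts differs
  from the lift of the bracket by the vertical vector -R(X, Y)w. In the tensor identity this
  remainder would survive on three horizontal lifts as h(R(X, Y)w, Z), and flatness removes it. The
  condition on \<open>M\<close> itself is the value on (X^H, Y^H, Z^V). Antisymmetry in the first
  two arguments leaves six of the eight types of triples to compute.\<close>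

abbreviation dd :: "('a::real_normed_vector \<Rightarrow> 'b::real_normed_vector) \<Rightarrow> 'a \<Rightarrow> 'a \<Rightarrow> 'b" where
  "dd f x \<equiv> frechet_derivative f (at x)"

lemma dd_eqI: "(f has_derivative f') (at x) \<Longrightarrow> dd f x = f'"
  by (metis frechet_derivative_at)

lemma has_derivative_dd: "f differentiable (at x) \<Longrightarrow> (f has_derivative dd f x) (at x)"
  by (simp add: frechet_derivative_works)

lemma linear_dd: "f differentiable (at x) \<Longrightarrow> linear (dd f x)"
  by (rule linear_frechet_derivative)

text \<open>\<open>frechet_derivative\<close> is a choice among all derivatives, so two functions
  with the same derivatives get the same value, even where no derivative exists.\<close>

lemma dd_cong:
  assumes "open S" "x \<in> S" "\<And>y. y \<in> S \<Longrightarrow> f y = g y"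
  shows "dd f x = dd g x"
proof -
  have "(f has_derivative f') (at x) \<longleftrightarrow> (g has_derivative f') (at x)" for f'
    using assms by (metis has_derivative_transform_within_open)
  then show ?thesis unfolding frechet_derivative_def by simp
qed

lemma differentiable_cong_open:
  assumes "open S" "x \<in> S" "\<And>y. y \<in> S \<Longrightarrow> f y = g y" "f differentiable (at x)"
  shows "g differentiable (at x)"
  using assms unfolding differentiable_def by (metis has_derivative_transform_within_open)

text \<open>Separates the base point of a derivative from its direction: the directions become fixed
  basis vectors, and the varying direction contributes scalar factors only.\<close>

lemma linear_eq_sum_Basis:
  fixes x :: "'a::euclidean_space"
  assumes "linear f"
  shows "f x = (\<Sum>b\<in>Basis. (x \<bullet> b) *\<^sub>R f b)"
  using assms by (metis (no_types, lifting) euclidean_representation linear_scale linear_sum sum.cong)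

section \<open>Closure properties of C^k maps\<close>

lemma Ck_on_cong_imp:
  assumes "open S" "\<And>x. x \<in> S \<Longrightarrow> f x = g x" "Ck_on k S f"
  shows "Ck_on k S g"
  using assms(2,3)
proof (induction k arbitrary: f g)
  case 0
  then show ?case by (simp cong: continuous_on_cong)
next
  case (Suc k)
  have "g differentiable (at x)" if "x \<in> S" for x
    using differentiable_cong_open[of S x f g] assms(1) Suc.prems that by auto
  moreover have "Ck_on k S (\<lambda>x. dd g x v)" for v
    by (rule Suc.IH[of "\<lambda>x. dd f x v"])
      (use Suc.prems assms(1) dd_cong[of S _ f g] in auto)
  ultimately show ?case by simp
qed

lemma Ck_on_subset: "Ck_on k S f \<Longrightarrow> T \<subseteq> S \<Longrightarrow> Ck_on k T f"
  by (induction k arbitrary: f) (auto intro: continuous_on_subset)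

lemma Ck_on_SucD: "Ck_on (Suc k) S f \<Longrightarrow> Ck_on k S f"
proof (induction k arbitrary: f)
  case 0
  then show ?case
    by (auto intro!: continuous_at_imp_continuous_on differentiable_imp_continuous_within)
next
  case (Suc k)
  show ?case unfolding Ck_on.simps(2)[of k]
    using Suc.IH Suc.prems unfolding Ck_on.simps(2)[of "Suc k"] by blast
qed

text \<open>Allows a different formula on each patch; \<open>smooth_on_glue\<close> and
  \<open>smooth_christoffel\<close> rest on it.\<close>

lemma Ck_on_local:
  assumes "\<And>x. x \<in> S \<Longrightarrow> \<exists>U. open U \<and> x \<in> U \<and> Ck_on k U f"
  shows "Ck_on k S f"
  using assms
proof (induction k arbitrary: f)
  case 0
  show ?case
    unfolding Ck_on.simps
    by (rule continuous_at_imp_continuous_on) (metis 0 Ck_on.simps(1) continuous_on_eq_continuous_at)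
next
  case (Suc k)
  show ?case unfolding Ck_on.simps using Suc.prems Suc.IH unfolding Ck_on.simps by (metis (no_types))
qed

lemma Ck_on_const: "Ck_on k S (\<lambda>x. c)"
  by (induction k arbitrary: c) auto

lemma Ck_on_bounded_linear:
  assumes S: "open S" and L: "bounded_linear L"
  shows "Ck_on k S f \<Longrightarrow> Ck_on k S (\<lambda>x. L (f x))"
proof (induction k arbitrary: f)
  case 0
  then show ?case using L by (simp add: bounded_linear.continuous_on)
next
  case (Suc k)
  have der: "((\<lambda>x. L (f x)) has_derivative (\<lambda>v. L (dd f x v))) (at x)" if "x \<in> S" for x
    using Suc.prems that by (auto intro!: bounded_linear.has_derivative[OF L] has_derivative_dd)
  have "Ck_on k S (\<lambda>x. dd (\<lambda>x. L (f x)) x v)" for v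
    by (rule Ck_on_cong_imp[OF S _ Suc.IH[of "\<lambda>x. dd f x v"]])
      (use Suc.prems der[THEN dd_eqI] in auto)
  with der show ?case by (auto simp: differentiable_def)
qed

lemma Ck_on_add:
  assumes S: "open S"
  shows "Ck_on k S f \<Longrightarrow> Ck_on k S g \<Longrightarrow> Ck_on k S (\<lambda>x. f x + g x)"
proof (induction k arbitrary: f g)
  case 0
  then show ?case by (simp add: continuous_on_add)
next
  case (Suc k)
  have der: "((\<lambda>x. f x + g x) has_derivative (\<lambda>v. dd f x v + dd g x v)) (at x)" if "x \<in> S" for x
    using Suc.prems that by (auto intro!: has_derivative_add has_derivative_dd)
  have "Ck_on k S (\<lambda>x. dd (\<lambda>x. f x + g x) x v)" for v
    by (rule Ck_on_cong_imp[OF S _ Suc.IH[of "\<lambda>x. dd f x v" "\<lambda>x. dd g x v"]])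
      (use Suc.prems der[THEN dd_eqI] in auto)
  with der show ?case by (auto simp: differentiable_def)
qed

lemma Ck_on_bounded_bilinear:
  assumes S: "open S" and B: "bounded_bilinear B"
  shows "Ck_on k S f \<Longrightarrow> Ck_on k S g \<Longrightarrow> Ck_on k S (\<lambda>x. B (f x) (g x))"
proof (induction k arbitrary: f g)
  case 0
  then show ?case by (simp add: bounded_bilinear.continuous_on[OF B])
next
  case (Suc k)
  have der: "((\<lambda>x. B (f x) (g x)) has_derivative (\<lambda>v. B (f x) (dd g x v) + B (dd f x v) (g x))) (at x)"
    if "x \<in> S" for x
    using Suc.prems that by (auto intro!: bounded_bilinear.FDERIV[OF B] has_derivative_dd)
  have fg: "Ck_on k S f" "Ck_on k S g" using Suc.prems by (blast intro: Ck_on_SucD)+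
  have "Ck_on k S (\<lambda>x. dd (\<lambda>x. B (f x) (g x)) x v)" for v
    by (rule Ck_on_cong_imp[OF S _
        Ck_on_add[OF S Suc.IH[of f "\<lambda>x. dd g x v"] Suc.IH[of "\<lambda>x. dd f x v" g]]])
      (use Suc.prems der[THEN dd_eqI] fg in auto)
  with der show ?case by (auto simp: differentiable_def)
qed

lemma Ck_on_sum:
  assumes "open S" "\<And>i. i \<in> I \<Longrightarrow> Ck_on k S (f i)"
  shows "Ck_on k S (\<lambda>x. \<Sum>i\<in>I. f i x)"
  using assms(2)
  by (induction I rule: infinite_finite_induct) (auto intro: Ck_on_const Ck_on_add[OF assms(1)])

text \<open>In the derivative of the composition both base point and direction vary. Expanding the
  direction in the basis leaves scalar multiples of \<open>dd g (f x) b\<close>, to which the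
  induction hypothesis applies because \<open>b\<close> is fixed.\<close>

lemma Ck_on_compose:
  fixes f :: "'a::euclidean_space \<Rightarrow> 'b::euclidean_space" and g :: "'b \<Rightarrow> 'c::real_normed_vector"
  assumes S: "open S" and T: "f ` S \<subseteq> T"
  shows "Ck_on k S f \<Longrightarrow> Ck_on k T g \<Longrightarrow> Ck_on k S (\<lambda>x. g (f x))"
proof (induction k arbitrary: g)
  case 0
  then show ?case using T by (simp add: continuous_on_compose2)
next
  case (Suc k)
  have gd: "g differentiable (at (f x))" if "x \<in> S" for x
    using Suc.prems(2) that T by auto
  have der: "((\<lambda>x. g (f x)) has_derivative (\<lambda>v. \<Sum>b\<in>Basis. (dd f x v \<bullet> b) *\<^sub>R dd g (f x) b)) (at x)"
    if "x \<in> S" for x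
  proof -
    have "((\<lambda>x. g (f x)) has_derivative (\<lambda>v. dd g (f x) (dd f x v))) (at x)"
      using Suc.prems that gd by (auto intro!: has_derivative_compose[of f _ x UNIV] has_derivative_dd)
    then show ?thesis by (simp only: linear_eq_sum_Basis[OF linear_dd[OF gd[OF that]], symmetric])
  qed
  have fk: "Ck_on k S f" using Suc.prems by (blast intro: Ck_on_SucD)
  have "Ck_on k S (\<lambda>x. (dd f x v \<bullet> b) *\<^sub>R dd g (f x) b)" for v b
    by (rule Ck_on_bounded_bilinear[OF S bounded_bilinear_scaleR],
        rule Ck_on_bounded_linear[OF S bounded_linear_inner_left])
      (use Suc.prems Suc.IH[of "\<lambda>x. dd g x b"] fk in auto)
  then have "Ck_on k S (\<lambda>x. \<Sum>b\<in>Basis. (dd f x v \<bullet> b) *\<^sub>R dd g (f x) b)" for v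
    by (intro Ck_on_sum[OF S])
  then have "Ck_on k S (\<lambda>x. dd (\<lambda>x. g (f x)) x v)" for v
    by (rule Ck_on_cong_imp[OF S, rotated]) (simp add: der[THEN dd_eqI])
  with der show ?case by (auto simp: differentiable_def)
qed

lemma Ck_on_ident: "Ck_on k S (\<lambda>x. x)"
  by (cases k) (auto simp: Ck_on_const)

section \<open>Smooth maps and evaluation of their derivatives\<close>

lemma smooth_on_differentiable: "smooth_on S f \<Longrightarrow> x \<in> S \<Longrightarrow> f differentiable (at x)"
  unfolding smooth_on_def by (metis Ck_on.simps(2))

lemma smooth_on_dd: "smooth_on S f \<Longrightarrow> smooth_on S (\<lambda>x. dd f x v)"
  unfolding smooth_on_def by (metis Ck_on.simps(2))

lemma smooth_on_continuous: "smooth_on S f \<Longrightarrow> continuous_on S f"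
  unfolding smooth_on_def by (metis Ck_on.simps(1))

lemma smooth_on_cong:
  "open S \<Longrightarrow> (\<And>x. x \<in> S \<Longrightarrow> f x = g x) \<Longrightarrow> smooth_on S f \<longleftrightarrow> smooth_on S g"
  unfolding smooth_on_def by (metis Ck_on_cong_imp)

lemma smooth_on_subset: "smooth_on S f \<Longrightarrow> T \<subseteq> S \<Longrightarrow> smooth_on T f"
  unfolding smooth_on_def by (metis Ck_on_subset)

lemma smooth_on_local:
  "(\<And>x. x \<in> S \<Longrightarrow> \<exists>U. open U \<and> x \<in> U \<and> smooth_on U f) \<Longrightarrow> smooth_on S f"
  unfolding smooth_on_def by (meson Ck_on_local)

lemma smooth_on_const: "smooth_on S (\<lambda>x. c)"
  unfolding smooth_on_def by (simp add: Ck_on_const)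

lemma smooth_on_ident: "smooth_on S (\<lambda>x. x)"
  unfolding smooth_on_def by (simp add: Ck_on_ident)

lemma smooth_on_bounded_linear:
  "open S \<Longrightarrow> bounded_linear L \<Longrightarrow> smooth_on S f \<Longrightarrow> smooth_on S (\<lambda>x. L (f x))"
  unfolding smooth_on_def by (metis Ck_on_bounded_linear)

lemma smooth_on_bounded_bilinear:
  "open S \<Longrightarrow> bounded_bilinear B \<Longrightarrow> smooth_on S f \<Longrightarrow> smooth_on S g \<Longrightarrow>
    smooth_on S (\<lambda>x. B (f x) (g x))"
  unfolding smooth_on_def by (metis Ck_on_bounded_bilinear)

lemma smooth_on_add:
  "open S \<Longrightarrow> smooth_on S f \<Longrightarrow> smooth_on S g \<Longrightarrow> smooth_on S (\<lambda>x. f x + g x)"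
  unfolding smooth_on_def by (metis Ck_on_add)

lemma smooth_on_sum:
  "open S \<Longrightarrow> (\<And>i. i \<in> I \<Longrightarrow> smooth_on S (f i)) \<Longrightarrow> smooth_on S (\<lambda>x. \<Sum>i\<in>I. f i x)"
  unfolding smooth_on_def by (metis Ck_on_sum)

lemma smooth_on_compose:
  fixes f :: "'a::euclidean_space \<Rightarrow> 'b::euclidean_space"
  shows "open S \<Longrightarrow> smooth_on S f \<Longrightarrow> smooth_on T g \<Longrightarrow> f ` S \<subseteq> T \<Longrightarrow> smooth_on S (\<lambda>x. g (f x))"
  unfolding smooth_on_def by (metis Ck_on_compose)

lemma smooth_on_scaleR:
  "open S \<Longrightarrow> smooth_on S f \<Longrightarrow> smooth_on S g \<Longrightarrow> smooth_on S (\<lambda>x. f x *\<^sub>R g x)"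
  by (rule smooth_on_bounded_bilinear[OF _ bounded_bilinear_scaleR])

lemma smooth_on_mult:
  fixes f g :: "'a::euclidean_space \<Rightarrow> real"
  shows "open S \<Longrightarrow> smooth_on S f \<Longrightarrow> smooth_on S g \<Longrightarrow> smooth_on S (\<lambda>x. f x * g x)"
  by (rule smooth_on_bounded_bilinear[OF _ bounded_bilinear_mult])

lemma smooth_on_uminus: "open S \<Longrightarrow> smooth_on S f \<Longrightarrow> smooth_on S (\<lambda>x. - f x)"
  by (rule smooth_on_bounded_linear[OF _ bounded_linear_minus[OF bounded_linear_ident]])

lemma smooth_on_diff:
  "open S \<Longrightarrow> smooth_on S f \<Longrightarrow> smooth_on S g \<Longrightarrow> smooth_on S (\<lambda>x. f x - g x)"
  using smooth_on_add[of S f "\<lambda>x. - g x"] smooth_on_uminus[of S g] by simp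

lemma smooth_on_inner_left: "open S \<Longrightarrow> smooth_on S f \<Longrightarrow> smooth_on S (\<lambda>x. f x \<bullet> b)"
  by (rule smooth_on_bounded_linear[OF _ bounded_linear_inner_left])

lemma smooth_on_fst: "open S \<Longrightarrow> smooth_on S f \<Longrightarrow> smooth_on S (\<lambda>x. fst (f x))"
  by (rule smooth_on_bounded_linear[OF _ bounded_linear_fst])

lemma smooth_on_snd: "open S \<Longrightarrow> smooth_on S f \<Longrightarrow> smooth_on S (\<lambda>x. snd (f x))"
  by (rule smooth_on_bounded_linear[OF _ bounded_linear_snd])

lemma smooth_on_Pair:
  assumes "open S" "smooth_on S f" "smooth_on S g"
  shows "smooth_on S (\<lambda>x. (f x, g x))"
proof -
  have "bounded_linear (\<lambda>y. (y, 0))" "bounded_linear (\<lambda>y. (0, y))"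
    by (simp_all add: bounded_linear_Pair bounded_linear_ident bounded_linear_zero)
  from smooth_on_add[OF assms(1) smooth_on_bounded_linear[OF assms(1) this(1) assms(2)]
      smooth_on_bounded_linear[OF assms(1) this(2) assms(3)]]
  show ?thesis by simp
qed

text \<open>Joint smoothness in base point and direction, reduced to fixed directions by the basis
  expansion.\<close>

lemma smooth_on_dd_apply:
  fixes f :: "'a::euclidean_space \<Rightarrow> 'b::real_normed_vector"
    and g :: "'c::euclidean_space \<Rightarrow> 'a"
  assumes S: "open S" and f: "smooth_on T f" and g: "smooth_on S g" and v: "smooth_on S v"
    and gS: "g ` S \<subseteq> T"
  shows "smooth_on S (\<lambda>x. dd f (g x) (v x))"
proof -
  have "smooth_on S (\<lambda>x. \<Sum>b\<in>Basis. (v x \<bullet> b) *\<^sub>R dd f (g x) b)"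
    by (intro smooth_on_sum smooth_on_scaleR smooth_on_inner_left S v
        smooth_on_compose[OF S g smooth_on_dd[OF f] gS])
  moreover have "(\<Sum>b\<in>Basis. (v x \<bullet> b) *\<^sub>R dd f (g x) b) = dd f (g x) (v x)" if "x \<in> S" for x
    by (rule linear_eq_sum_Basis[symmetric], rule linear_dd, rule smooth_on_differentiable[OF f])
      (use that gS in blast)
  ultimately show ?thesis by (rule smooth_on_cong[OF S, THEN iffD1, rotated])
qed

lemma smooth_on_has_derivative: "smooth_on S f \<Longrightarrow> x \<in> S \<Longrightarrow> (f has_derivative dd f x) (at x)"
  by (rule has_derivative_dd) (rule smooth_on_differentiable)

lemma dd_compose:
  assumes "f differentiable (at x)" "g differentiable (at (f x))"
  shows "dd (\<lambda>y. g (f y)) x v = dd g (f x) (dd f x v)"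
  using has_derivative_compose[OF has_derivative_dd[OF assms(1)] has_derivative_dd[OF assms(2)], THEN dd_eqI]
  by simp

text \<open>A product rule for evaluating a linear map that depends on a point: with the argument
  expanded in the basis it becomes the rule for scalar multiples. It serves for derivatives of
  transition maps and for the Christoffel form.\<close>

lemma has_derivative_linear_family:
  fixes F :: "'d::real_normed_vector \<Rightarrow> 'a::euclidean_space \<Rightarrow> 'b::real_normed_vector"
    and g :: "'c::real_normed_vector \<Rightarrow> 'd"
  assumes F: "\<And>z. z \<in> T \<Longrightarrow> linear (F z)" and D: "\<And>b. (\<lambda>z. F z b) differentiable (at (g x))"
    and g: "g differentiable (at x)" and v: "v differentiable (at x)"
    and T: "open T" "g x \<in> T"
  shows "((\<lambda>y. F (g y) (v y)) has_derivative
           (\<lambda>w. dd (\<lambda>z. F z (v x)) (g x) (dd g x w) + F (g x) (dd v x w))) (at x)"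
proof -
  have gc: "isCont g x" by (simp add: differentiable_imp_continuous_within g)
  obtain U where U: "open U" "x \<in> U" "g ` U \<subseteq> T"
    using gc T unfolding continuous_at_open by (metis image_subset_iff)
  have "((\<lambda>y. \<Sum>b\<in>Basis. (v y \<bullet> b) *\<^sub>R F (g y) b) has_derivative
     (\<lambda>w. \<Sum>b\<in>Basis. (v x \<bullet> b) *\<^sub>R dd (\<lambda>z. F z b) (g x) (dd g x w) + (dd v x w \<bullet> b) *\<^sub>R F (g x) b)) (at x)"
    by (intro has_derivative_sum has_derivative_scaleR has_derivative_inner_left has_derivative_dd[OF v]
        has_derivative_compose[OF has_derivative_dd[OF g] has_derivative_dd[OF D]])
  moreover have "(\<Sum>b\<in>Basis. (v x \<bullet> b) *\<^sub>R dd (\<lambda>z. F z b) (g x) u) = dd (\<lambda>z. F z (v x)) (g x) u" for u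
  proof -
    have "((\<lambda>z. \<Sum>b\<in>Basis. (v x \<bullet> b) *\<^sub>R F z b) has_derivative
        (\<lambda>u. \<Sum>b\<in>Basis. (v x \<bullet> b) *\<^sub>R dd (\<lambda>z. F z b) (g x) u)) (at (g x))"
      by (intro has_derivative_sum has_derivative_scaleR_right has_derivative_dd D)
    then have "((\<lambda>z. F z (v x)) has_derivative
        (\<lambda>u. \<Sum>b\<in>Basis. (v x \<bullet> b) *\<^sub>R dd (\<lambda>z. F z b) (g x) u)) (at (g x))"
      by (rule has_derivative_transform_within_open[OF _ T])
        (rule linear_eq_sum_Basis[OF F, symmetric])
    then show ?thesis by (simp add: dd_eqI)
  qed
  ultimately have "((\<lambda>y. \<Sum>b\<in>Basis. (v y \<bullet> b) *\<^sub>R F (g y) b) has_derivative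
     (\<lambda>w. dd (\<lambda>z. F z (v x)) (g x) (dd g x w) + F (g x) (dd v x w))) (at x)"
    by (simp add: sum.distrib linear_eq_sum_Basis[OF F[OF T(2)], symmetric])
  then show ?thesis
    by (rule has_derivative_transform_within_open[OF _ U(1,2)])
      (rule linear_eq_sum_Basis[OF F, symmetric], use U(3) in blast)
qed

lemma dd_dd_apply:
  fixes f :: "'a::euclidean_space \<Rightarrow> 'b::real_normed_vector" and g :: "'c::real_normed_vector \<Rightarrow> 'a"
  assumes f: "smooth_on T f" and g: "g differentiable (at x)" and v: "v differentiable (at x)"
    and T: "open T" "g x \<in> T"
  shows "((\<lambda>y. dd f (g y) (v y)) has_derivative
           (\<lambda>w. dd (\<lambda>z. dd f z (v x)) (g x) (dd g x w) + dd f (g x) (dd v x w))) (at x)"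
  by (rule has_derivative_linear_family[OF _ _ g v T])
    (use T(2) in \<open>auto intro!: linear_dd smooth_on_differentiable[OF f]
      smooth_on_differentiable[OF smooth_on_dd[OF f]]\<close>)

text \<open>The mean value theorem is applied along \<open>u\<close> to the difference of
  \<open>f\<close> and its shift by \<open>h *\<^sub>R v\<close>, and then along \<open>v\<close>.
  The left side is symmetric in \<open>u\<close> and \<open>v\<close>, which makes it the tool for
  exchanging derivatives.\<close>

lemma mixed_difference:
  fixes f :: "'a::euclidean_space \<Rightarrow> real"
  assumes f: "smooth_on S f" and d: "ball x d \<subseteq> S" and h: "0 < h" "h * (norm u + norm v) < d"
  shows "\<exists>y\<in>ball x d. f (x + h *\<^sub>R u + h *\<^sub>R v) - f (x + h *\<^sub>R u) - f (x + h *\<^sub>R v) + f x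
           = h * (h * dd (\<lambda>z. dd f z u) y v)"
proof -
  have in_ball: "x + s *\<^sub>R u + t *\<^sub>R v \<in> ball x d" if "0 \<le> s" "s \<le> h" "0 \<le> t" "t \<le> h" for s t
  proof -
    have "norm (s *\<^sub>R u + t *\<^sub>R v) \<le> s * norm u + t * norm v"
      using norm_triangle_ineq[of "s *\<^sub>R u" "t *\<^sub>R v"] that by simp
    also have "\<dots> \<le> h * norm u + h * norm v"
      using that by (intro add_mono mult_right_mono) auto
    finally have "norm (s *\<^sub>R u + t *\<^sub>R v) < d"
      using h by (simp add: distrib_left)
    moreover have "dist x (x + s *\<^sub>R u + t *\<^sub>R v) = norm (s *\<^sub>R u + t *\<^sub>R v)"
      by (subst dist_commute) (simp add: dist_norm add.assoc)
    ultimately show ?thesis by simp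
  qed
  have line: "((\<lambda>t. g (c + t *\<^sub>R w)) has_real_derivative dd g (c + t *\<^sub>R w) w) (at t)"
    if "g differentiable (at (c + t *\<^sub>R w))" for g :: "'a \<Rightarrow> real" and c w t
  proof -
    have "((\<lambda>t. g (c + t *\<^sub>R w)) has_derivative (\<lambda>s. dd g (c + t *\<^sub>R w) (s *\<^sub>R w))) (at t)"
      by (rule has_derivative_compose[where f = "\<lambda>t. c + t *\<^sub>R w", OF _ has_derivative_dd[OF that]]) (auto intro!: derivative_eq_intros)
    moreover have "dd g (c + t *\<^sub>R w) (s *\<^sub>R w) = dd g (c + t *\<^sub>R w) w * s" for s
      using linear_scale[OF linear_dd[OF that]] by simp
    ultimately show ?thesis by (simp add: has_field_derivative_def)
  qed
  have "((\<lambda>s. f ((x + h *\<^sub>R v) + s *\<^sub>R u) - f (x + s *\<^sub>R u)) has_real_derivative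
      dd f ((x + h *\<^sub>R v) + s *\<^sub>R u) u - dd f (x + s *\<^sub>R u) u) (at s)" if "0 \<le> s" "s \<le> h" for s
    using in_ball[of s h] in_ball[of s 0] that d h
    by (intro DERIV_diff line smooth_on_differentiable[OF f]) (auto simp: add_ac)
  from MVT2[OF h(1) this] obtain s where s: "0 < s" "s < h"
    and 1: "f ((x + h *\<^sub>R v) + h *\<^sub>R u) - f (x + h *\<^sub>R u) - (f (x + h *\<^sub>R v) - f x)
      = h * (dd f ((x + h *\<^sub>R v) + s *\<^sub>R u) u - dd f (x + s *\<^sub>R u) u)"
    by auto
  have "((\<lambda>t. dd f ((x + s *\<^sub>R u) + t *\<^sub>R v) u) has_real_derivative
      dd (\<lambda>z. dd f z u) ((x + s *\<^sub>R u) + t *\<^sub>R v) v) (at t)" if "0 \<le> t" "t \<le> h" for t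
    using in_ball[of s t] that s d
    by (intro line smooth_on_differentiable[OF smooth_on_dd[OF f]]) auto
  from MVT2[OF h(1) this] obtain t where t: "0 < t" "t < h"
    and 2: "dd f ((x + s *\<^sub>R u) + h *\<^sub>R v) u - dd f (x + s *\<^sub>R u) u
      = h * dd (\<lambda>z. dd f z u) ((x + s *\<^sub>R u) + t *\<^sub>R v) v"
    by auto
  have "x + s *\<^sub>R u + t *\<^sub>R v \<in> ball x d" using in_ball s t by simp
  moreover have "f (x + h *\<^sub>R u + h *\<^sub>R v) - f (x + h *\<^sub>R u) - f (x + h *\<^sub>R v) + f x
      = h * (h * dd (\<lambda>z. dd f z u) ((x + s *\<^sub>R u) + t *\<^sub>R v) v)"
    using 1 2 by (simp add: add_ac)
  ultimately show ?thesis by blast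
qed

text \<open>The mixed second difference is the same number in either order, so by continuity the two
  derivatives at \<open>x\<close> differ by less than every positive \<open>e\<close>.\<close>

lemma dd_dd_commute_real:
  fixes f :: "'a::euclidean_space \<Rightarrow> real"
  assumes f: "smooth_on S f" and S: "open S" "x \<in> S"
  shows "dd (\<lambda>z. dd f z u) x v = dd (\<lambda>z. dd f z v) x u"
proof -
  let ?P = "\<lambda>u v y. dd (\<lambda>z. dd f z u) y v"
  have cont: "isCont (?P u v) x" for u v
    using smooth_on_continuous[OF smooth_on_dd[OF smooth_on_dd[OF f]]] S
    by (metis continuous_on_eq_continuous_at)
  have "\<bar>?P u v x - ?P v u x\<bar> \<le> 0 + e" if "0 < e" for e
  proof -
    obtain d0 where d0: "0 < d0" "ball x d0 \<subseteq> S" using S open_contains_ball by metis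
    obtain d1 where d1: "0 < d1" "\<And>y. dist y x < d1 \<Longrightarrow> dist (?P u v y) (?P u v x) < e / 2"
      using cont[of u v, unfolded continuous_at_eps_delta] \<open>0 < e\<close> half_gt_zero by metis
    obtain d2 where d2: "0 < d2" "\<And>y. dist y x < d2 \<Longrightarrow> dist (?P v u y) (?P v u x) < e / 2"
      using cont[of v u, unfolded continuous_at_eps_delta] \<open>0 < e\<close> half_gt_zero by metis
    define d where "d = min d0 (min d1 d2)"
    have d: "0 < d" "ball x d \<subseteq> S" using d0 d1 d2 by (auto simp: d_def)
    \<comment> \<open>Small enough for the whole parallelogram to stay in the ball; the summand 1
      keeps the denominator positive when \<open>u\<close> and \<open>v\<close> are zero.\<close>
    define h where "h = d / (2 * (norm u + norm v + 1))"
    have pos: "0 < 2 * (norm u + norm v + 1)" by (simp add: add_nonneg_pos)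
    then have h: "0 < h" using d by (simp add: h_def)
    have "h * (norm u + norm v) < d"
    proof -
      have "norm u + norm v < 2 * (norm u + norm v + 1)" by (smt (verit) norm_ge_zero)
      then have "d * (norm u + norm v) < d * (2 * (norm u + norm v + 1))" using d by simp
      then show ?thesis using pos by (simp add: h_def field_simps)
    qed
    with mixed_difference[OF f d(2) h(1), of u v] mixed_difference[OF f d(2) h(1), of v u]
    obtain y z where yz: "y \<in> ball x d" "z \<in> ball x d" "h * (h * ?P u v y) = h * (h * ?P v u z)"
      by (auto simp: algebra_simps)
    then have "?P u v y = ?P v u z" using h by simp
    moreover have "dist (?P u v y) (?P u v x) < e / 2" "dist (?P v u z) (?P v u x) < e / 2"
      by (rule d1(2) d2(2), use yz(1,2) in \<open>simp add: d_def dist_commute\<close>)+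
    ultimately show ?thesis unfolding dist_real_def by (smt (verit) field_sum_of_halves)
  qed
  then have "\<bar>?P u v x - ?P v u x\<bar> \<le> 0" by (rule field_le_epsilon)
  then show ?thesis by simp
qed

lemma dd_dd_commute:
  fixes f :: "'a::euclidean_space \<Rightarrow> 'b::euclidean_space"
  assumes f: "smooth_on S f" and S: "open S" "x \<in> S"
  shows "dd (\<lambda>z. dd f z u) x v = dd (\<lambda>z. dd f z v) x u"
proof (rule euclidean_eqI)
  fix b :: 'b
  have eq: "dd (\<lambda>z. dd f z u) x v \<bullet> b = dd (\<lambda>z. dd (\<lambda>y. f y \<bullet> b) z u) x v" for u v
  proof -
    have "((\<lambda>z. dd f z u \<bullet> b) has_derivative (\<lambda>v. dd (\<lambda>z. dd f z u) x v \<bullet> b)) (at x)"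
      by (intro has_derivative_inner_left smooth_on_has_derivative[OF smooth_on_dd[OF f] S(2)])
    moreover have "dd (\<lambda>y. f y \<bullet> b) z u = dd f z u \<bullet> b" if "z \<in> S" for z
      by (intro fun_cong[OF dd_eqI] has_derivative_inner_left smooth_on_has_derivative[OF f that])
    ultimately show ?thesis
      using dd_cong[OF S, of "\<lambda>z. dd (\<lambda>y. f y \<bullet> b) z u" "\<lambda>z. dd f z u \<bullet> b"] by (simp add: dd_eqI)
  qed
  show "dd (\<lambda>z. dd f z u) x v \<bullet> b = dd (\<lambda>z. dd f z v) x u \<bullet> b"
    using dd_dd_commute_real[OF smooth_on_inner_left[OF S(1) f] S] by (simp add: eq)
qed

text \<open>The function t^(-n) exp(-1/t), extended by zero. With the parameter \<open>n\<close> the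
  derivatives are again linear combinations of members of the family, so smoothness follows by one
  induction for all \<open>n\<close>; the bump function is built from \<open>n = 0\<close>.\<close>

definition exp_recip :: "nat \<Rightarrow> real \<Rightarrow> real" where
  "exp_recip n t = (if t > 0 then inverse t ^ n * exp (- inverse t) else 0)"

lemma exp_recip_tendsto_0: "(exp_recip n \<longlongrightarrow> 0) (at 0)"
proof -
  have "((\<lambda>x::real. x ^ n / exp x) \<longlongrightarrow> 0) at_top" by (rule tendsto_power_div_exp_0)
  then have "((\<lambda>t::real. inverse t ^ n / exp (inverse t)) \<longlongrightarrow> 0) (at_right 0)"
    by (rule filterlim_compose[OF _ filterlim_inverse_at_top_right])
  then have "(exp_recip n \<longlongrightarrow> 0) (at_right 0)"
    by (rule Lim_transform_eventually)
      (auto simp: exp_recip_def eventually_at_filter exp_minus divide_inverse)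
  moreover have "(exp_recip n \<longlongrightarrow> 0) (at_left 0)"
    by (rule tendsto_eventually) (auto simp: exp_recip_def eventually_at_filter)
  ultimately show ?thesis by (simp add: filterlim_split_at_real)
qed

lemma exp_recip_deriv:
  "(exp_recip n has_real_derivative (- real n * exp_recip (Suc n) t + exp_recip (Suc (Suc n)) t)) (at t)"
proof -
  consider "t > 0" | "t < 0" | "t = 0" by linarith
  then show ?thesis
  proof cases
    case 1
    have "((\<lambda>t. inverse t ^ n * exp (- inverse t)) has_real_derivative
        (- real n * exp_recip (Suc n) t + exp_recip (Suc (Suc n)) t)) (at t)"
      using 1 by (auto intro!: derivative_eq_intros simp: exp_recip_def)
        (cases n; simp add: field_simps power2_eq_square)
    then show ?thesis
      by (rule has_field_derivative_transform_within_open[of _ _ _ "{0<..}"])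
        (use 1 in \<open>auto simp: exp_recip_def\<close>)
  next
    case 2
    have "(exp_recip n has_real_derivative 0) (at t)"
      by (rule has_field_derivative_transform_within_open[of "\<lambda>t. 0" _ _ "{..<0}"])
        (use 2 in \<open>auto simp: exp_recip_def\<close>)
    then show ?thesis using 2 by (simp add: exp_recip_def)
  next
    case 3
    \<comment> \<open>At 0 the difference quotient of \<open>exp_recip n\<close> is
      \<open>exp_recip (Suc n)\<close>, which tends to 0.\<close>
    have "((\<lambda>h. (exp_recip n (0 + h) - exp_recip n 0) / h) \<longlongrightarrow> 0) (at 0)"
    proof (rule Lim_transform_eventually[OF exp_recip_tendsto_0[of "Suc n"]])
      show "\<forall>\<^sub>F h in at 0. exp_recip (Suc n) h = (exp_recip n (0 + h) - exp_recip n 0) / h"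
        by (auto simp: exp_recip_def eventually_at_filter divide_inverse)
    qed
    then show ?thesis using 3 by (simp add: DERIV_def exp_recip_def)
  qed
qed

lemma smooth_on_exp_recip: "smooth_on UNIV (exp_recip n)"
proof -
  have "Ck_on k UNIV (exp_recip n)" for k
  proof (induction k arbitrary: n)
    case 0
    have "isCont (exp_recip n) x" for x using exp_recip_deriv DERIV_isCont by blast
    then show ?case by (simp add: continuous_at_imp_continuous_on)
  next
    case (Suc k)
    have der: "(exp_recip n has_derivative
        (*) (- real n * exp_recip (Suc n) t + exp_recip (Suc (Suc n)) t)) (at t)" for t
      using exp_recip_deriv[of n t] by (simp add: has_field_derivative_def)
    have "Ck_on k UNIV (\<lambda>t. (- real n * exp_recip (Suc n) t + exp_recip (Suc (Suc n)) t) * v)" for v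
      by (intro Ck_on_bounded_linear[OF open_UNIV bounded_linear_mult_left] Ck_on_add
          Ck_on_bounded_linear[OF open_UNIV bounded_linear_mult_right] Suc.IH open_UNIV)
    then show ?case using der by (auto simp: dd_eqI[OF der] differentiable_def)
  qed
  then show ?thesis by (simp add: smooth_on_def)
qed

text \<open>Nesting two copies of \<open>exp (-1/t)\<close> gives a function that is constant for \<open>t \<le> 1\<close> and
  vanishes for \<open>t \<ge> 2\<close>, without having to divide by a partition-of-unity denominator.\<close>

lemma smooth_bump_exists:
  fixes x :: "'a::euclidean_space"
  assumes "0 < r"
  obtains \<rho> :: "'a \<Rightarrow> real" where "smooth_on UNIV \<rho>" "\<And>y. dist x y < r / 2 \<Longrightarrow> \<rho> y = 1"
    "\<And>y. dist x y > r \<Longrightarrow> \<rho> y = 0"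
proof -
  let ?e = "exp_recip 0"
  define \<psi> where "\<psi> t = ?e (?e 1 - ?e (t - 1)) / ?e (?e 1)" for t
  \<comment> \<open>The squared distance is smooth at the centre as well. The factor
    \<open>2 / r\<^sup>2\<close> sends distance \<open>r\<close> to 2 and distance
    \<open>r / 2\<close> to 1/2, below the threshold 1.\<close>
  define \<rho> where "\<rho> y = \<psi> (2 / r\<^sup>2 * ((y - x) \<bullet> (y - x)))" for y :: 'a
  have pos: "?e 1 > 0" "?e (?e 1) > 0" by (auto simp: exp_recip_def)
  have psi1: "\<psi> t = 1" if "t \<le> 1" for t
    using that pos by (simp add: \<psi>_def exp_recip_def)
  have psi0: "\<psi> t = 0" if "t \<ge> 2" for t
  proof -
    have "?e (t - 1) \<ge> ?e 1" using that by (simp add: exp_recip_def field_simps)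
    then show ?thesis by (simp add: \<psi>_def exp_recip_def[of 0 "?e 1 - ?e (t - 1)"])
  qed
  have comp: "smooth_on UNIV (\<lambda>y. ?e (f y))" if "smooth_on UNIV f" for f :: "'c::euclidean_space \<Rightarrow> real"
    using smooth_on_compose[OF open_UNIV that smooth_on_exp_recip] by simp
  have psi: "smooth_on UNIV \<psi>"
    unfolding \<psi>_def divide_inverse
    by (intro smooth_on_mult comp smooth_on_diff smooth_on_const smooth_on_ident open_UNIV)
  have arg: "smooth_on UNIV (\<lambda>y. 2 / r\<^sup>2 * ((y - x) \<bullet> (y - x)))"
    by (intro smooth_on_mult smooth_on_bounded_bilinear[OF _ bounded_bilinear_inner]
        smooth_on_diff smooth_on_const smooth_on_ident open_UNIV)
  have "smooth_on UNIV \<rho>"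
    unfolding \<rho>_def using smooth_on_compose[OF open_UNIV arg psi subset_UNIV] .
  moreover have "\<rho> y = 1" if "dist x y < r / 2" for y
  proof -
    have "(dist x y)\<^sup>2 \<le> (r / 2)\<^sup>2" using that by (intro power_mono) auto
    then show ?thesis unfolding \<rho>_def using assms
      by (intro psi1) (simp add: dot_square_norm dist_norm norm_minus_commute field_simps power2_eq_square,
          smt (verit) zero_le_square)
  qed
  moreover have "\<rho> y = 0" if "dist x y > r" for y
  proof -
    have "(dist x y)\<^sup>2 \<ge> r\<^sup>2" using that assms by (intro power_mono) auto
    then show ?thesis unfolding \<rho>_def using assms
      by (intro psi0) (simp add: dot_square_norm dist_norm norm_minus_commute field_simps)
  qed
  ultimately show ?thesis using that by blast
qed

section \<open>Charts, bump functions and local frames\<close>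

lemma points_iff: "p \<in> points M \<longleftrightarrow> (\<exists>i. p \<in> chart_dom M i)"
  by (auto simp: points_def)

text \<open>\<open>topology\<close> returns the given predicate only if that predicate is a
  topology. Injectivity of the charts is what makes their images commute with intersections.\<close>

lemma openin_manifold_topology:
  assumes inj: "\<And>i. inj_on (chart_map M i) (chart_dom M i)"
  shows "openin (manifold_topology M) V \<longleftrightarrow>
    V \<subseteq> points M \<and> (\<forall>i. open (chart_map M i ` (V \<inter> chart_dom M i)))"
proof -
  have "istopology (\<lambda>V. V \<subseteq> points M \<and> (\<forall>i. open (chart_map M i ` (V \<inter> chart_dom M i))))"
    unfolding istopology_def
  proof (intro conjI allI impI)
    fix S T i
    assume S: "S \<subseteq> points M \<and> (\<forall>i. open (chart_map M i ` (S \<inter> chart_dom M i)))"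
      and T: "T \<subseteq> points M \<and> (\<forall>i. open (chart_map M i ` (T \<inter> chart_dom M i)))"
    show "S \<inter> T \<subseteq> points M" using S by auto
    have "chart_map M i ` (S \<inter> T \<inter> chart_dom M i)
        = chart_map M i ` (S \<inter> chart_dom M i) \<inter> chart_map M i ` (T \<inter> chart_dom M i)"
      using inj[of i] unfolding inj_on_def by blast
    then show "open (chart_map M i ` (S \<inter> T \<inter> chart_dom M i))" using S T by auto
  next
    fix K i
    assume K: "\<forall>S\<in>K. S \<subseteq> points M \<and> (\<forall>i. open (chart_map M i ` (S \<inter> chart_dom M i)))"
    show "\<Union>K \<subseteq> points M" using K by auto
    have "chart_map M i ` (\<Union>K \<inter> chart_dom M i) = (\<Union>S\<in>K. chart_map M i ` (S \<inter> chart_dom M i))"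
      by auto
    then show "open (chart_map M i ` (\<Union>K \<inter> chart_dom M i))" using K by auto
  qed
  then show ?thesis by (simp add: manifold_topology_def topology_inverse')
qed

text \<open>\<open>smooth_manifold\<close> without its two topological clauses. For
  \<open>TM\<close> these are proved last, with the chart calculus of this locale already
  instantiated to \<open>TM\<close>.\<close>

locale charted =
  fixes M :: "('a, 'i, 'b::euclidean_space) atlas"
  assumes inj: "\<And>i. inj_on (chart_map M i) (chart_dom M i)"
    and open_img: "\<And>i. open (chart_img M i)"
    and open_overlap_raw: "\<And>i j. open (chart_map M i ` (chart_dom M i \<inter> chart_dom M j))"
    and smooth_transition_raw:
      "\<And>i j. smooth_on (chart_map M i ` (chart_dom M i \<inter> chart_dom M j)) (transition M i j)"
begin

abbreviation "\<phi> \<equiv> chart_map M"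
abbreviation "\<psi> \<equiv> chart_inv M"
abbreviation "\<tau> \<equiv> transition M"
abbreviation "dm \<equiv> chart_dom M"
abbreviation "im \<equiv> chart_img M"

definition overlap :: "'i \<Rightarrow> 'i \<Rightarrow> 'b set" where
  "overlap i j = \<phi> i ` (dm i \<inter> dm j)"

lemma open_overlap: "open (overlap i j)"
  by (simp add: overlap_def open_overlap_raw)

lemma smooth_transition: "smooth_on (overlap i j) (\<tau> i j)"
  by (simp add: overlap_def smooth_transition_raw)

lemma inv_map [simp]: "p \<in> dm i \<Longrightarrow> \<psi> i (\<phi> i p) = p"
  by (simp add: chart_inv_def inv_into_f_f inj)

lemma map_inv [simp]: "x \<in> im i \<Longrightarrow> \<phi> i (\<psi> i x) = x"
  by (simp add: chart_inv_def chart_img_def f_inv_into_f)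

lemma inv_in_dom [simp]: "x \<in> im i \<Longrightarrow> \<psi> i x \<in> dm i"
  by (simp add: chart_inv_def chart_img_def inv_into_into)

lemma map_in_img [simp]: "p \<in> dm i \<Longrightarrow> \<phi> i p \<in> im i"
  by (simp add: chart_img_def)

lemma dom_in_points: "p \<in> dm i \<Longrightarrow> p \<in> points M"
  by (auto simp: points_iff)

lemma inv_in_points [simp]: "x \<in> im i \<Longrightarrow> \<psi> i x \<in> points M"
  by (rule dom_in_points) (rule inv_in_dom)

lemma overlap_iff: "x \<in> overlap i j \<longleftrightarrow> x \<in> im i \<and> \<psi> i x \<in> dm j"
proof
  show "x \<in> overlap i j" if "x \<in> im i \<and> \<psi> i x \<in> dm j"
    using that unfolding overlap_def by (intro image_eqI[of _ _ "\<psi> i x"]) simp_all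
qed (auto simp: overlap_def)

lemma map_in_overlap [simp]: "p \<in> dm i \<Longrightarrow> p \<in> dm j \<Longrightarrow> \<phi> i p \<in> overlap i j"
  by (simp add: overlap_iff)

lemma transition_eq: "\<tau> i j x = \<phi> j (\<psi> i x)"
  by (simp add: transition_def)

lemma transition_in_overlap: "x \<in> overlap i j \<Longrightarrow> \<tau> i j x \<in> overlap j i"
  by (simp add: overlap_iff transition_eq)

lemma inv_transition: "x \<in> overlap i j \<Longrightarrow> \<psi> j (\<tau> i j x) = \<psi> i x"
  by (simp add: overlap_iff transition_eq)

lemma transition_differentiable: "x \<in> overlap i j \<Longrightarrow> \<tau> i j differentiable (at x)"
  by (rule smooth_on_differentiable[OF smooth_transition])

lemma dd_transition_self: "x \<in> im i \<Longrightarrow> dd (\<tau> i i) x w = w"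
  using dd_cong[OF open_img, of x i "\<tau> i i" "\<lambda>x. x"] by (simp add: transition_eq)

text \<open>The chain rule: near \<open>x\<close> the map \<open>\<tau> i k\<close> is the
  composition of \<open>\<tau> i j\<close> and \<open>\<tau> j k\<close>.\<close>

lemma dd_transition_cocycle:
  assumes "x \<in> overlap i j" "x \<in> overlap i k"
  shows "dd (\<tau> j k) (\<tau> i j x) (dd (\<tau> i j) x w) = dd (\<tau> i k) x w"
proof -
  have "dd (\<tau> i k) x = dd (\<lambda>y. \<tau> j k (\<tau> i j y)) x"
    by (rule dd_cong[of "overlap i j \<inter> overlap i k"])
      (use assms in \<open>auto simp: open_overlap overlap_iff transition_eq\<close>)
  moreover have "\<tau> i j x \<in> overlap j k" using assms by (simp add: overlap_iff transition_eq)
  ultimately show ?thesis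
    using dd_compose[OF transition_differentiable[OF assms(1)] transition_differentiable] by metis
qed

section \<open>Tangent vectors in charts\<close>

lemma tangent_transition:
  "v \<in> tangent_space M p \<Longrightarrow> p \<in> dm i \<Longrightarrow> p \<in> dm j \<Longrightarrow> v j = dd (\<tau> i j) (\<phi> i p) (v i)"
  unfolding tangent_space_def by blast

lemma tangent_outside: "v \<in> tangent_space M p \<Longrightarrow> p \<notin> dm i \<Longrightarrow> v i = 0"
  unfolding tangent_space_def by blast

lemma tangentI:
  assumes "\<And>i j. p \<in> dm i \<Longrightarrow> p \<in> dm j \<Longrightarrow> v j = dd (\<tau> i j) (\<phi> i p) (v i)"
    "\<And>i. p \<notin> dm i \<Longrightarrow> v i = 0"
  shows "v \<in> tangent_space M p"
  unfolding tangent_space_def using assms by blast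

lemma tangent_eqI:
  assumes "u \<in> tangent_space M p" "v \<in> tangent_space M p" "p \<in> dm i" "u i = v i"
  shows "u = v"
proof
  show "u j = v j" for j
  proof (cases "p \<in> dm j")
    case True
    then show ?thesis
      using tangent_transition[OF assms(1,3) True] tangent_transition[OF assms(2,3) True] assms(4) by simp
  next
    case False
    then show ?thesis using tangent_outside[OF assms(1)] tangent_outside[OF assms(2)] by simp
  qed
qed

lemma linear_dd_transition: "p \<in> dm i \<Longrightarrow> p \<in> dm j \<Longrightarrow> linear (dd (\<tau> i j) (\<phi> i p))"
  by (intro linear_dd transition_differentiable) simp

lemma tangent_zero: "0 \<in> tangent_space M p"
  by (rule tangentI) (simp_all add: linear_0 linear_dd_transition)

lemma tangent_add:
  assumes "u \<in> tangent_space M p" "v \<in> tangent_space M p"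
  shows "u + v \<in> tangent_space M p"
proof (rule tangentI)
  fix i j assume p: "p \<in> dm i" "p \<in> dm j"
  show "(u + v) j = dd (\<tau> i j) (\<phi> i p) ((u + v) i)"
    using assms[THEN tangent_transition, OF p] p by (simp add: linear_add linear_dd_transition)
qed (simp add: assms[THEN tangent_outside])

lemma tangent_scale:
  assumes "u \<in> tangent_space M p"
  shows "(\<lambda>i. r *\<^sub>R u i) \<in> tangent_space M p"
proof (rule tangentI)
  fix i j assume p: "p \<in> dm i" "p \<in> dm j"
  show "r *\<^sub>R u j = dd (\<tau> i j) (\<phi> i p) (r *\<^sub>R u i)"
    using assms[THEN tangent_transition, OF p] p by (simp add: linear_scale linear_dd_transition)
qed (simp add: assms[THEN tangent_outside])

lemma tangent_diff: "u \<in> tangent_space M p \<Longrightarrow> v \<in> tangent_space M p \<Longrightarrow> u - v \<in> tangent_space M p"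
  using tangent_add[OF _ tangent_scale, of u p v "-1"] by (simp add: plus_fun_def fun_diff_def)

text \<open>The inverse of reading off component \<open>i\<close>; it parametrises the fibres of the
  tangent bundle over chart \<open>i\<close>.\<close>

definition coord_vector :: "'i \<Rightarrow> 'a \<Rightarrow> 'b \<Rightarrow> 'i \<Rightarrow> 'b" where
  "coord_vector i p w = (\<lambda>j. if p \<in> dm j then dd (\<tau> i j) (\<phi> i p) w else 0)"

lemma coord_vector_tangent: "p \<in> dm i \<Longrightarrow> coord_vector i p w \<in> tangent_space M p"
  unfolding tangent_space_def coord_vector_def
proof (safe; simp)
  fix k j assume "p \<in> dm i" "p \<in> dm j" "p \<in> dm k"
  then show "dd (\<tau> i j) (\<phi> i p) w = dd (\<tau> k j) (\<phi> k p) (dd (\<tau> i k) (\<phi> i p) w)"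
    using dd_transition_cocycle[of "\<phi> i p" i k j w] by (simp add: transition_eq)
qed

lemma coord_vector_self: "p \<in> dm i \<Longrightarrow> coord_vector i p w i = w"
  by (simp add: coord_vector_def dd_transition_self)

section \<open>The manifold topology seen through charts\<close>

lemma openin_iff:
  "openin (manifold_topology M) V \<longleftrightarrow> V \<subseteq> points M \<and> (\<forall>i. open (\<phi> i ` (V \<inter> dm i)))"
  by (rule openin_manifold_topology[OF inj])

lemma topspace_eq: "topspace (manifold_topology M) = points M"
proof -
  have "\<phi> i ` (points M \<inter> dm i) = im i" for i
    using dom_in_points by (force simp: chart_img_def)
  then have "openin (manifold_topology M) (points M)" by (simp add: openin_iff open_img)
  then show ?thesis by (metis openin_iff openin_subset openin_topspace subset_antisym)
qed

lemma preimage_inv: "{x \<in> im i. \<psi> i x \<in> V} = \<phi> i ` (V \<inter> dm i)"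
  by (auto simp: image_iff) (metis IntI inv_in_dom map_inv)

text \<open>In chart \<open>j\<close> the set becomes the preimage of \<open>W\<close> under
  \<open>\<tau> j i\<close>, which is continuous on an open overlap.\<close>

lemma openin_inv_image:
  assumes "open W" "W \<subseteq> im i"
  shows "openin (manifold_topology M) (\<psi> i ` W)"
  unfolding openin_iff
proof (intro conjI allI)
  show "\<psi> i ` W \<subseteq> points M" using assms by auto
  fix j
  have "\<phi> j ` (\<psi> i ` W \<inter> dm j) = \<tau> j i -` W \<inter> overlap j i"
  proof (intro set_eqI iffI)
    fix y assume "y \<in> \<phi> j ` (\<psi> i ` W \<inter> dm j)"
    then obtain x where "x \<in> W" "\<psi> i x \<in> dm j" "y = \<phi> j (\<psi> i x)" by auto
    moreover from this have "x \<in> im i" using assms by auto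
    ultimately show "y \<in> \<tau> j i -` W \<inter> overlap j i" by (auto simp: transition_eq overlap_iff)
  next
    fix y assume "y \<in> \<tau> j i -` W \<inter> overlap j i"
    then have y: "\<tau> j i y \<in> W" "y \<in> overlap j i" by auto
    then have "\<psi> i (\<tau> j i y) = \<psi> j y" by (simp add: inv_transition)
    with y show "y \<in> \<phi> j ` (\<psi> i ` W \<inter> dm j)"
      by (auto simp: overlap_iff image_iff intro!: bexI[of _ "\<psi> j y"]) (metis imageI)
  qed
  moreover have "open (\<tau> j i -` W \<inter> overlap j i)"
    using smooth_on_continuous[OF smooth_transition] assms(1) open_overlap
    by (simp add: continuous_on_open_vimage)
  ultimately show "open (\<phi> j ` (\<psi> i ` W \<inter> dm j))" by simp
qed

lemma openin_chart: "openin (manifold_topology M) V \<Longrightarrow> open (\<phi> i ` (V \<inter> dm i))"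
  by (simp add: openin_iff)

text \<open>A countable basis of the model space, carried over by the inverses of the charts in
  \<open>I\<close>, is a basis. The index type itself may be uncountable, hence the set
  \<open>I\<close>.\<close>

lemma second_countable_of_cover:
  assumes "countable I" "points M \<subseteq> (\<Union>i\<in>I. dm i)"
  shows "second_countable (manifold_topology M)"
proof -
  obtain B :: "'b set set" where B: "countable B" "\<And>W. W \<in> B \<Longrightarrow> open W"
    "\<And>W x. open W \<Longrightarrow> x \<in> W \<Longrightarrow> \<exists>V\<in>B. x \<in> V \<and> V \<subseteq> W"
    by (metis topological_basisE[of _ _ _] ex_countable_basis topological_basis_open)
  define C where "C = (\<lambda>(i, W). \<psi> i ` (W \<inter> im i)) ` (I \<times> B)"
  have "countable C" using assms(1) B(1) by (simp add: C_def)
  moreover have "openin (manifold_topology M) V" if "V \<in> C" for V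
    using that B(2) open_img by (auto simp: C_def intro!: openin_inv_image)
  moreover have "\<exists>V\<in>C. p \<in> V \<and> V \<subseteq> U" if U: "openin (manifold_topology M) U" and p: "p \<in> U" for U p
  proof -
    have "p \<in> points M" using openin_subset[OF U] p by (auto simp: topspace_eq)
    then obtain i where i: "i \<in> I" "p \<in> dm i" using assms(2) by auto
    obtain W where W: "W \<in> B" "\<phi> i p \<in> W" "W \<subseteq> \<phi> i ` (U \<inter> dm i)"
      using B(3)[OF openin_chart[OF U], of "\<phi> i p" i] i p by auto
    have "\<psi> i ` (W \<inter> im i) \<subseteq> U" using W(3) by auto
    moreover have "p \<in> \<psi> i ` (W \<inter> im i)" using W(2) i by (auto simp: image_iff intro!: bexI[of _ "\<phi> i p"])
    ultimately show ?thesis using i W by (auto simp: C_def)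
  qed
  ultimately show ?thesis unfolding second_countable_def by blast
qed

section \<open>Vector fields, derivations and brackets in charts\<close>

lemma vector_field_tangent: "vector_field M X \<Longrightarrow> X p \<in> tangent_space M p"
  by (simp add: vector_field_def)

lemma vector_field_smooth: "vector_field M X \<Longrightarrow> smooth_on (im i) (\<lambda>x. X (\<psi> i x) i)"
  by (simp add: vector_field_def)

lemma vector_field_transition:
  "vector_field M X \<Longrightarrow> x \<in> overlap i j \<Longrightarrow> X (\<psi> j (\<tau> i j x)) j = dd (\<tau> i j) x (X (\<psi> i x) i)"
  using tangent_transition[OF vector_field_tangent, of X "\<psi> i x" i j]
  by (simp add: inv_transition) (simp add: overlap_iff)

lemma vector_field_add: "vector_field M X \<Longrightarrow> vector_field M Y \<Longrightarrow> vector_field M (X + Y)"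
  unfolding vector_field_def by (auto intro!: tangent_add smooth_on_add open_img)

lemma vector_field_zero: "vector_field M 0"
  unfolding vector_field_def by (auto intro!: tangent_zero smooth_on_const)

lemma vector_field_fscale: "smooth_fun M f \<Longrightarrow> vector_field M X \<Longrightarrow> vector_field M (fscale f X)"
  unfolding vector_field_def smooth_fun_def fscale_def
  by (auto intro!: tangent_scale smooth_on_scaleR open_img simp: o_def)

lemma smooth_fun_smooth: "smooth_fun M f \<Longrightarrow> smooth_on (im i) (\<lambda>x. f (\<psi> i x))"
  by (simp add: smooth_fun_def o_def)

text \<open>\<open>vf_apply\<close> differentiates in a chart picked by \<open>SOME\<close>; the
  chain rule for the transition map carries the value to any chart around \<open>p\<close>.\<close>

lemma vf_apply_chart:
  assumes f: "smooth_fun M f" and X: "X p \<in> tangent_space M p" and p: "p \<in> dm i"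
  shows "vf_apply M X f p = dd (\<lambda>x. f (\<psi> i x)) (\<phi> i p) (X p i)"
proof -
  define j where "j = (SOME i. p \<in> dm i)"
  have j: "p \<in> dm j" unfolding j_def using p by (rule someI)
  have x: "\<phi> j p \<in> overlap j i" using p j by simp
  have "dd (\<lambda>x. f (\<psi> j x)) (\<phi> j p) (X p j) = dd (\<lambda>x. f (\<psi> i (\<tau> j i x))) (\<phi> j p) (X p j)"
    by (rule fun_cong, rule dd_cong[OF open_overlap x]) (simp add: inv_transition)
  also have "\<dots> = dd (\<lambda>x. f (\<psi> i x)) (\<tau> j i (\<phi> j p)) (dd (\<tau> j i) (\<phi> j p) (X p j))"
    using j p by (intro dd_compose transition_differentiable x smooth_on_differentiable[OF smooth_fun_smooth[OF f]])
      (simp add: transition_eq)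
  also have "\<dots> = dd (\<lambda>x. f (\<psi> i x)) (\<phi> i p) (X p i)"
    using tangent_transition[OF X j p] j by (simp add: transition_eq)
  finally show ?thesis by (simp add: vf_apply_def j_def[symmetric] o_def Let_def)
qed

text \<open>Tensor identities are available at points of \<open>M\<close> only, and
  \<open>vf_apply\<close> sees a function only through inverse charts, that is, at such
  points.\<close>

lemma vf_apply_cong:
  assumes "\<And>q. q \<in> points M \<Longrightarrow> f q = g q" "p \<in> points M"
  shows "vf_apply M X f p = vf_apply M X g p"
proof -
  define j where "j = (SOME i. p \<in> dm i)"
  have j: "p \<in> dm j" unfolding j_def using assms(2) points_iff by (metis someI)
  have "dd (f \<circ> \<psi> j) (\<phi> j p) = dd (g \<circ> \<psi> j) (\<phi> j p)"
    by (rule dd_cong[OF open_img, of _ j]) (use j assms(1) in auto)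
  then show ?thesis by (simp add: vf_apply_def j_def[symmetric] Let_def)
qed

lemma lie_bracket_chart:
  "p \<in> dm i \<Longrightarrow> lie_bracket M X Y p i = dd (\<lambda>x. Y (\<psi> i x) i) (\<phi> i p) (X p i)
     - dd (\<lambda>x. X (\<psi> i x) i) (\<phi> i p) (Y p i)"
  by (simp add: lie_bracket_def)

text \<open>Differentiating the transformation law of one field along the other produces a second
  derivative of the transition map. It is symmetric in the two fields and drops out of the
  bracket.\<close>

lemma lie_bracket_tangent:
  assumes X: "vector_field M X" and Y: "vector_field M Y"
  shows "lie_bracket M X Y p \<in> tangent_space M p"
proof -
  have half: "dd (\<lambda>x. Y (\<psi> j x) j) (\<phi> j p) (X p j) =
      dd (\<lambda>z. dd (\<tau> i j) z (Y p i)) (\<phi> i p) (X p i)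
      + dd (\<tau> i j) (\<phi> i p) (dd (\<lambda>x. Y (\<psi> i x) i) (\<phi> i p) (X p i))"
    if X: "vector_field M X" and Y: "vector_field M Y" and p: "p \<in> dm i" "p \<in> dm j" for X Y i j
  proof -
    have x: "\<phi> i p \<in> overlap i j" using p by simp
    have t: "\<tau> i j (\<phi> i p) = \<phi> j p" using p by (simp add: transition_eq)
    have d: "(\<lambda>x. Y (\<psi> k x) k) differentiable (at (\<phi> k p))" if "p \<in> dm k" for k
      using that by (intro smooth_on_differentiable[OF vector_field_smooth[OF Y]]) simp
    have "dd (\<lambda>x. Y (\<psi> j x) j) (\<phi> j p) (X p j)
        = dd (\<lambda>x. Y (\<psi> j x) j) (\<tau> i j (\<phi> i p)) (dd (\<tau> i j) (\<phi> i p) (X p i))"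
      using tangent_transition[OF vector_field_tangent[OF X] p] t by simp
    also have "\<dots> = dd (\<lambda>x. Y (\<psi> j (\<tau> i j x)) j) (\<phi> i p) (X p i)"
      by (rule dd_compose[symmetric]) (use x t d p in \<open>simp_all add: transition_differentiable\<close>)
    also have "dd (\<lambda>x. Y (\<psi> j (\<tau> i j x)) j) (\<phi> i p) = dd (\<lambda>x. dd (\<tau> i j) x (Y (\<psi> i x) i)) (\<phi> i p)"
      by (rule dd_cong[OF open_overlap x]) (simp add: vector_field_transition[OF Y])
    also have "\<dots> (X p i) = dd (\<lambda>z. dd (\<tau> i j) z (Y p i)) (\<phi> i p) (X p i)
      + dd (\<tau> i j) (\<phi> i p) (dd (\<lambda>x. Y (\<psi> i x) i) (\<phi> i p) (X p i))"
      using dd_dd_apply[where g = "\<lambda>x. x", OF smooth_transition _ d[OF p(1)] open_overlap x, THEN dd_eqI] p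
      by simp
    finally show ?thesis .
  qed
  show ?thesis
    unfolding tangent_space_def
  proof (safe)
    fix i j assume p: "p \<in> dm i" "p \<in> dm j"
    have "dd (\<lambda>z. dd (\<tau> i j) z (Y p i)) (\<phi> i p) (X p i) = dd (\<lambda>z. dd (\<tau> i j) z (X p i)) (\<phi> i p) (Y p i)"
      by (rule dd_dd_commute[OF smooth_transition open_overlap]) (use p in simp)
    then show "lie_bracket M X Y p j = dd (\<tau> i j) (\<phi> i p) (lie_bracket M X Y p i)"
      using half[OF X Y p] half[OF Y X p] p by (simp add: lie_bracket_chart linear_diff linear_dd_transition)
  qed (simp add: lie_bracket_def)
qed

lemma vector_field_lie_bracket:
  assumes X: "vector_field M X" and Y: "vector_field M Y"
  shows "vector_field M (lie_bracket M X Y)"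
proof -
  have "smooth_on (im i) (\<lambda>x. dd (\<lambda>x. Y (\<psi> i x) i) x (X (\<psi> i x) i) - dd (\<lambda>x. X (\<psi> i x) i) x (Y (\<psi> i x) i))" for i
    by (intro smooth_on_diff smooth_on_dd_apply[where T = "im i"] open_img vector_field_smooth
        smooth_on_ident X Y) auto
  then have "smooth_on (im i) (\<lambda>x. lie_bracket M X Y (\<psi> i x) i)" for i
    by (rule smooth_on_cong[OF open_img, THEN iffD1, rotated]) (simp add: lie_bracket_chart)
  then show ?thesis using lie_bracket_tangent[OF X Y] by (simp add: vector_field_def)
qed

end

locale manifold =
  fixes M :: "('a, 'i, 'b::euclidean_space) atlas"
  assumes smooth_manifold: "smooth_manifold M"

sublocale manifold \<subseteq> charted
  using smooth_manifold by unfold_locales (simp_all add: smooth_manifold_def)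

context manifold
begin

text \<open>The image of \<open>K\<close> in \<open>M\<close> is compact, hence closed because
  \<open>M\<close> is Hausdorff.\<close>

lemma open_off_compact:
  assumes K: "compact K" "K \<subseteq> im i"
  shows "open {x \<in> im j. \<psi> j x \<notin> \<psi> i ` K}"
proof -
  have "continuous_map (top_of_set (im i)) (manifold_topology M) (\<psi> i)"
    unfolding continuous_map_def topspace_eq
    by (auto simp: preimage_inv openin_iff open_img openin_open_eq)
  moreover have "compactin (top_of_set (im i)) K" using K by (simp add: compactin_subtopology)
  ultimately have "compactin (manifold_topology M) (\<psi> i ` K)" by (rule image_compactin[rotated])
  then have "closedin (manifold_topology M) (\<psi> i ` K)"
    using smooth_manifold by (intro compactin_imp_closedin) (simp_all add: smooth_manifold_def)
  then have "openin (manifold_topology M) (points M - \<psi> i ` K)" by (simp add: closedin_def topspace_eq)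
  then have "open (\<phi> j ` ((points M - \<psi> i ` K) \<inter> dm j))" by (rule openin_chart)
  moreover have "\<phi> j ` ((points M - \<psi> i ` K) \<inter> dm j) = {x \<in> im j. \<psi> j x \<notin> \<psi> i ` K}"
    unfolding preimage_inv[symmetric] by auto
  ultimately show ?thesis by simp
qed

text \<open>Extension by zero: the overlap and the set that avoids the image of \<open>K\<close> are
  open and together cover the chart image.\<close>

lemma smooth_on_glue:
  assumes K: "compact K" "K \<subseteq> im i" and f: "smooth_on (overlap j i) f"
    and 0: "\<And>x. x \<in> im j \<Longrightarrow> \<psi> j x \<notin> \<psi> i ` K \<Longrightarrow> f x = 0"
  shows "smooth_on (im j) f"
proof (rule smooth_on_local)
  fix x assume x: "x \<in> im j"
  show "\<exists>U. open U \<and> x \<in> U \<and> smooth_on U f"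
  proof (cases "\<psi> j x \<in> \<psi> i ` K")
    case True
    then have "x \<in> overlap j i" using x K(2) inv_in_dom by (auto simp: overlap_iff)
    then show ?thesis using f open_overlap by blast
  next
    case False
    let ?U = "{x \<in> im j. \<psi> j x \<notin> \<psi> i ` K}"
    have "smooth_on ?U f"
      by (rule smooth_on_cong[OF open_off_compact[OF K], THEN iffD1, OF _ smooth_on_const[of _ 0]])
        (use 0 in simp)
    then show ?thesis using open_off_compact[OF K] False x by blast
  qed
qed

text \<open>The field \<open>E w\<close> is the constant coordinate field \<open>w\<close> of the chart \<open>i\<close>, cut off by \<open>\<eta>\<close>.\<close>

lemma local_frame:
  assumes p: "p \<in> dm i"
  obtains \<eta> E U where "open U" "\<phi> i p \<in> U" "U \<subseteq> im i"
    "\<And>x. x \<in> U \<Longrightarrow> \<eta> (\<psi> i x) = 1"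
    "\<And>q. q \<notin> dm i \<Longrightarrow> \<eta> q = 0"
    "\<And>f. smooth_on (im i) f \<Longrightarrow> smooth_fun M (\<lambda>q. \<eta> q * f (\<phi> i q))"
    "\<And>w. vector_field M (E w)"
    "\<And>w q. q \<in> dm i \<Longrightarrow> E w q i = \<eta> q *\<^sub>R w"
    "\<And>w q. q \<notin> dm i \<Longrightarrow> E w q = 0"
proof -
  \<comment> \<open>A closed ball, because extension by zero asks for a compact set inside the chart
    image outside of which everything vanishes.\<close>
  obtain r where r: "0 < r" "cball (\<phi> i p) r \<subseteq> im i"
    using open_img[of i] p open_contains_cball by (metis map_in_img)
  obtain \<rho> :: "'b \<Rightarrow> real" where \<rho>: "smooth_on UNIV \<rho>" "\<And>y. dist (\<phi> i p) y < r / 2 \<Longrightarrow> \<rho> y = 1"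
    "\<And>y. dist (\<phi> i p) y > r \<Longrightarrow> \<rho> y = 0" using smooth_bump_exists[OF r(1), of "\<phi> i p"] by blast
  define \<eta> where "\<eta> q = (if q \<in> dm i then \<rho> (\<phi> i q) else 0)" for q
  define E where "E w q = (\<lambda>j. \<eta> q *\<^sub>R coord_vector i q w j)" for w q
  let ?K = "cball (\<phi> i p) r"
  have K: "compact ?K" "?K \<subseteq> im i" using r by auto
  have off: "\<eta> (\<psi> j x) = 0" if "x \<in> im j" "\<psi> j x \<notin> \<psi> i ` ?K" for j x
  proof (cases "\<psi> j x \<in> dm i")
    case True
    then have "\<phi> i (\<psi> j x) \<notin> ?K" using that(2) by (metis imageI inv_map)
    then show ?thesis using \<rho>(3) True by (simp add: \<eta>_def)
  qed (simp add: \<eta>_def)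
  have \<rho>\<tau>: "smooth_on (overlap j i) (\<lambda>x. \<rho> (\<tau> j i x))" for j
    by (rule smooth_on_compose[OF open_overlap smooth_transition \<rho>(1)]) simp
  have \<tau>im: "\<tau> j i ` overlap j i \<subseteq> overlap i j" for j using transition_in_overlap by auto
  have oim: "overlap i j \<subseteq> im i" for j by (auto simp: overlap_iff)
  have 1: "smooth_fun M (\<lambda>q. \<eta> q * f (\<phi> i q))" if f: "smooth_on (im i) f" for f
    unfolding smooth_fun_def o_def
  proof (rule allI, rule smooth_on_glue[OF K])
    fix j
    have "smooth_on (overlap j i) (\<lambda>x. \<rho> (\<tau> j i x) * f (\<tau> j i x))"
      by (intro smooth_on_mult open_overlap \<rho>\<tau> smooth_on_compose[OF open_overlap smooth_transition f])
        (use \<tau>im[of j] oim[of j] in blast)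
    then show "smooth_on (overlap j i) (\<lambda>x. \<eta> (\<psi> j x) * f (\<phi> i (\<psi> j x)))"
      by (rule smooth_on_cong[OF open_overlap, THEN iffD1, rotated])
        (simp add: \<eta>_def overlap_iff transition_eq)
  qed (simp add: off)
  have 2: "vector_field M (E w)" for w
    unfolding vector_field_def
  proof (intro conjI allI)
    show "E w q \<in> tangent_space M q" for q
    proof (cases "q \<in> dm i")
      case False
      then show ?thesis using tangent_zero[of q] by (simp add: E_def \<eta>_def zero_fun_def)
    next
      case True
      then show ?thesis unfolding E_def by (intro tangent_scale coord_vector_tangent)
    qed
    show "smooth_on (im j) (\<lambda>x. E w (\<psi> j x) j)" for j
    proof (rule smooth_on_glue[OF K])
      have "smooth_on (overlap j i) (\<lambda>x. \<rho> (\<tau> j i x) *\<^sub>R dd (\<tau> i j) (\<tau> j i x) w)"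
        by (intro smooth_on_scaleR open_overlap \<rho>\<tau>
            smooth_on_dd_apply[OF open_overlap smooth_transition smooth_transition smooth_on_const] \<tau>im)
      then show "smooth_on (overlap j i) (\<lambda>x. E w (\<psi> j x) j)"
        by (rule smooth_on_cong[OF open_overlap, THEN iffD1, rotated])
          (simp add: E_def coord_vector_def \<eta>_def overlap_iff transition_eq)
    qed (simp add: E_def off)
  qed
  show ?thesis
  proof (rule that[of "ball (\<phi> i p) (r / 2)" \<eta> E])
    show "ball (\<phi> i p) (r / 2) \<subseteq> im i" using r by (auto simp: subset_iff)
    then show "\<eta> (\<psi> i x) = 1" if "x \<in> ball (\<phi> i p) (r / 2)" for x
      using that \<rho>(2) by (auto simp: \<eta>_def subset_iff)
  qed (use r 1 2 in \<open>auto simp: \<eta>_def E_def coord_vector_self zero_fun_def\<close>)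
qed

text \<open>The cut-off frame supplies a global field with a prescribed value, so statements about
  global fields can be read pointwise. Where there is no chart the zero field serves.\<close>

lemma extend_tangent:
  assumes "v \<in> tangent_space M p"
  obtains X where "vector_field M X" "X p = v"
proof (cases "p \<in> points M")
  case True
  then obtain i where i: "p \<in> dm i" by (auto simp: points_iff)
  obtain \<eta> E U where E: "\<phi> i p \<in> U" "\<And>x. x \<in> U \<Longrightarrow> \<eta> (\<psi> i x) = 1"
    "\<And>w. vector_field M (E w)" "\<And>w q. q \<in> dm i \<Longrightarrow> E w q i = \<eta> q *\<^sub>R w"
    by (rule local_frame[OF i]) blast
  have "E (v i) p i = v i" using E(2)[OF E(1)] E(4)[OF i] i by simp
  then have "E (v i) p = v" using tangent_eqI[OF vector_field_tangent[OF E(3)] assms i] by simp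
  then show ?thesis using that E(3) by blast
next
  case False
  then have "v = 0" using assms by (auto simp: tangent_space_def points_iff)
  then show ?thesis using that[OF vector_field_zero] by (simp add: zero_fun_def)
qed

end

section \<open>Tensoriality and Christoffel symbols\<close>

lemma sum_vfield_apply: "(\<Sum>b\<in>I. F b) q i = (\<Sum>b\<in>I. F b q i)"
  by (induction I rule: infinite_finite_induct) auto

context manifold
begin

text \<open>Linearity over smooth functions, evaluated at \<open>p\<close>. The target is any real
  vector space because components of a connection, with values in the model space, are treated along
  with real expressions.\<close>

definition tensorial :: "(('a, 'i, 'b) vfield \<Rightarrow> 'c::real_vector) \<Rightarrow> 'a \<Rightarrow> bool" where
  "tensorial T p \<longleftrightarrow>
     (\<forall>X Y. vector_field M X \<longrightarrow> vector_field M Y \<longrightarrow> T (X + Y) = T X + T Y) \<and>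
     (\<forall>f X. smooth_fun M f \<longrightarrow> vector_field M X \<longrightarrow> T (fscale f X) = f p *\<^sub>R T X)"

lemma tensorialI:
  assumes "\<And>X Y. vector_field M X \<Longrightarrow> vector_field M Y \<Longrightarrow> T (X + Y) = T X + T Y"
    "\<And>f X. smooth_fun M f \<Longrightarrow> vector_field M X \<Longrightarrow> T (fscale f X) = f p *\<^sub>R T X"
  shows "tensorial T p"
  using assms by (simp add: tensorial_def)

lemma tensorial_add:
  "tensorial T p \<Longrightarrow> vector_field M X \<Longrightarrow> vector_field M Y \<Longrightarrow> T (X + Y) = T X + T Y"
  by (simp add: tensorial_def)

lemma tensorial_fscale:
  "tensorial T p \<Longrightarrow> smooth_fun M f \<Longrightarrow> vector_field M X \<Longrightarrow> T (fscale f X) = f p *\<^sub>R T X"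
  by (simp add: tensorial_def)

lemma tensorial_zero: "tensorial T p \<Longrightarrow> T 0 = 0"
  using tensorial_add[OF _ vector_field_zero vector_field_zero, of T p] by simp

lemma vector_field_sum:
  "(\<And>b. b \<in> I \<Longrightarrow> vector_field M (F b)) \<Longrightarrow> vector_field M (\<Sum>b\<in>I. F b)"
  by (induction I rule: infinite_finite_induct) (auto intro: vector_field_zero vector_field_add)

lemma tensorial_sum:
  assumes T: "tensorial T p" and "\<And>b. b \<in> I \<Longrightarrow> vector_field M (F b)"
  shows "T (\<Sum>b\<in>I. F b) = (\<Sum>b\<in>I. T (F b))"
  using assms(2)
  by (induction I rule: infinite_finite_induct)
    (auto simp: tensorial_zero[OF T] tensorial_add[OF T] vector_field_sum)

lemma smooth_fun_const: "smooth_fun M (\<lambda>q. c)"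
  by (simp add: smooth_fun_def o_def smooth_on_const)

text \<open>The field \<open>W\<close> times the square of the cut-off is a global combination of
  frame fields with coefficients vanishing at \<open>p\<close>, and the cut-off is 1 at
  \<open>p\<close>. The square is there because coefficients and frame fields each carry one
  factor.\<close>

lemma tensorial_eq_0:
  assumes T: "tensorial T p" and W: "vector_field M W" and p: "p \<in> points M" "W p = 0"
  shows "T W = 0"
proof -
  obtain i where i: "p \<in> dm i" using p by (auto simp: points_iff)
  obtain \<eta> E U where fr: "\<phi> i p \<in> U" "\<And>x. x \<in> U \<Longrightarrow> \<eta> (\<psi> i x) = 1"
    "\<And>q. q \<notin> dm i \<Longrightarrow> \<eta> q = 0"
    "\<And>f. smooth_on (im i) f \<Longrightarrow> smooth_fun M (\<lambda>q. \<eta> q * f (\<phi> i q))"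
    "\<And>w. vector_field M (E w)"
    "\<And>w q. q \<in> dm i \<Longrightarrow> E w q i = \<eta> q *\<^sub>R w"
    "\<And>w q. q \<notin> dm i \<Longrightarrow> E w q = 0"
    by (rule local_frame[OF i]) blast
  have \<eta>: "smooth_fun M \<eta>" using fr(4)[OF smooth_on_const[of _ 1]] by simp
  have \<eta>1: "\<eta> p = 1" using fr(2)[OF fr(1)] i by simp
  \<comment> \<open>\<open>\<psi> i (\<phi> i q)\<close> is \<open>q\<close> on the chart; written
    this way the coefficient has the form that \<open>local_frame\<close> shows to be
    smooth.\<close>
  define c where "c b q = \<eta> q * (W (\<psi> i (\<phi> i q)) i \<bullet> b)" for b q
  have c: "smooth_fun M (c b)" for b
    unfolding c_def by (intro fr(4) smooth_on_inner_left open_img vector_field_smooth W)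
  have vf: "vector_field M (fscale (c b) (E b))" for b
    by (intro vector_field_fscale c fr(5))
  have vf1: "vector_field M (fscale \<eta> (fscale \<eta> W))"
    by (intro vector_field_fscale \<eta> W)
  have "fscale \<eta> (fscale \<eta> W) = (\<Sum>b\<in>Basis. fscale (c b) (E b))"
  proof
    fix q
    show "fscale \<eta> (fscale \<eta> W) q = (\<Sum>b\<in>Basis. fscale (c b) (E b)) q"
    proof (cases "q \<in> dm i")
      case True
      have "(\<Sum>b\<in>Basis. fscale (c b) (E b) q i) = (\<Sum>b\<in>Basis. (\<eta> q * \<eta> q) *\<^sub>R ((W q i \<bullet> b) *\<^sub>R b))"
        using True by (intro sum.cong) (simp_all add: fscale_def c_def fr(6) mult_ac)
      also have "\<dots> = (\<eta> q * \<eta> q) *\<^sub>R W q i"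
        by (simp only: scaleR_sum_right[symmetric] euclidean_representation)
      finally show ?thesis
        by (intro tangent_eqI[OF _ _ True] vector_field_tangent vf1 vector_field_sum vf)
          (simp add: sum_vfield_apply, simp add: fscale_def)
    next
      case False
      then show ?thesis
        by (auto simp: fun_eq_iff sum_vfield_apply fscale_def fr(3,7))
    qed
  qed
  then have "T (fscale \<eta> (fscale \<eta> W)) = (\<Sum>b\<in>Basis. c b p *\<^sub>R T (E b))"
    by (simp add: tensorial_sum[OF T vf] tensorial_fscale[OF T c fr(5)])
  moreover have "c b p = 0" for b using p(2) i by (simp add: c_def)
  ultimately show ?thesis
    using \<eta>1 by (simp add: tensorial_fscale[OF T] vector_field_fscale \<eta> W)
qed

lemma tensorial_cong:
  assumes T: "tensorial T p" and X: "vector_field M X" and Y: "vector_field M Y"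
    and p: "p \<in> points M" "X p = Y p"
  shows "T X = T Y"
proof -
  let ?N = "fscale (\<lambda>q. -1) Y"
  have N: "vector_field M ?N" by (rule vector_field_fscale[OF smooth_fun_const Y])
  have "T (X + ?N) = 0"
    by (rule tensorial_eq_0[OF T vector_field_add[OF X N] p(1)])
      (use p(2) in \<open>simp add: fscale_def fun_eq_iff\<close>)
  then show ?thesis
    by (simp add: tensorial_add[OF T X N] tensorial_fscale[OF T smooth_fun_const Y])
qed

text \<open>By \<open>tensorial_cong\<close> only the value at \<open>p\<close> counts, so the
  coefficients may be frozen there and are constant functions.\<close>

lemma tensorial_Basis:
  assumes T: "tensorial T p" and X: "vector_field M X" and p: "p \<in> dm i"
    and E: "\<And>b. vector_field M (E b)" "\<And>b. E b p i = b"
  shows "T X = (\<Sum>b\<in>Basis. (X p i \<bullet> b) *\<^sub>R T (E b))"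
proof -
  let ?Z = "\<Sum>b\<in>Basis. fscale (\<lambda>q. X p i \<bullet> b) (E b)"
  have vf: "vector_field M (fscale (\<lambda>q. X p i \<bullet> b) (E b))" for b
    by (intro vector_field_fscale smooth_fun_const E)
  have Z: "vector_field M ?Z" by (intro vector_field_sum vf)
  have "?Z p i = X p i" by (simp add: sum_vfield_apply fscale_def E(2) euclidean_representation)
  then have "X p = ?Z p"
    by (intro tangent_eqI[OF _ _ p] vector_field_tangent X Z) simp
  then have "T X = T ?Z" using p by (intro tensorial_cong[OF T X Z]) (auto simp: points_iff)
  then show ?thesis by (simp add: tensorial_sum[OF T vf] tensorial_fscale[OF T smooth_fun_const E(1)])
qed

end

locale affine_manifold = manifold M
  for M :: "('a, 'i, 'b::euclidean_space) atlas" +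
  fixes D :: "('a, 'i, 'b) conn"
  assumes conn: "affine_connection M D"
begin

lemma conn_vector_field: "vector_field M X \<Longrightarrow> vector_field M Y \<Longrightarrow> vector_field M (D X Y)"
  using conn unfolding affine_connection_def by blast

lemma conn_add_left:
  "vector_field M X \<Longrightarrow> vector_field M X' \<Longrightarrow> vector_field M Y \<Longrightarrow> D (X + X') Y = D X Y + D X' Y"
  using conn unfolding affine_connection_def by blast

lemma conn_fscale_left:
  "smooth_fun M f \<Longrightarrow> vector_field M X \<Longrightarrow> vector_field M Y \<Longrightarrow> D (fscale f X) Y = fscale f (D X Y)"
  using conn unfolding affine_connection_def by blast

lemma conn_add_right:
  "vector_field M X \<Longrightarrow> vector_field M Y \<Longrightarrow> vector_field M Y' \<Longrightarrow> D X (Y + Y') = D X Y + D X Y'"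
  using conn unfolding affine_connection_def by blast

lemma conn_fscale_right:
  "smooth_fun M f \<Longrightarrow> vector_field M X \<Longrightarrow> vector_field M Y \<Longrightarrow>
    D X (fscale f Y) = fscale f (D X Y) + fscale (vf_apply M X f) Y"
  using conn unfolding affine_connection_def by blast

lemma tensorial_conn_left: "vector_field M Y \<Longrightarrow> tensorial (\<lambda>X. D X Y p i) p"
  by (rule tensorialI) (simp_all add: conn_add_left conn_fscale_left, simp add: fscale_def)

text \<open>The connection and the coordinate derivative have the same Leibniz term, which cancels
  in the difference; what remains is the Christoffel part.\<close>

lemma tensorial_conn_right:
  assumes X: "vector_field M X" and p: "p \<in> dm i"
  shows "tensorial (\<lambda>Y. D X Y p i - dd (\<lambda>x. Y (\<psi> i x) i) (\<phi> i p) (X p i)) p"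
proof -
  have der: "((\<lambda>x. Y (\<psi> i x) i) has_derivative dd (\<lambda>x. Y (\<psi> i x) i) (\<phi> i p)) (at (\<phi> i p))"
    if "vector_field M Y" for Y
    by (rule smooth_on_has_derivative[OF vector_field_smooth[OF that]]) (use p in simp)
  show ?thesis
  proof (rule tensorialI, goal_cases)
    case (1 Y Y')
    then show ?case
      using has_derivative_add[OF der[OF 1(1)] der[OF 1(2)], THEN dd_eqI]
      by (simp add: conn_add_right X)
  next
    case (2 f Y)
    have f: "((\<lambda>x. f (\<psi> i x)) has_derivative dd (\<lambda>x. f (\<psi> i x)) (\<phi> i p)) (at (\<phi> i p))"
      by (rule smooth_on_has_derivative[OF smooth_fun_smooth[OF 2(1)]]) (use p in simp)
    have "dd (\<lambda>x. fscale f Y (\<psi> i x) i) (\<phi> i p) v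
        = f p *\<^sub>R dd (\<lambda>x. Y (\<psi> i x) i) (\<phi> i p) v + dd (\<lambda>x. f (\<psi> i x)) (\<phi> i p) v *\<^sub>R Y p i" for v
      using has_derivative_scaleR[OF f der[OF 2(2)], THEN dd_eqI] p by (simp add: fscale_def)
    then show ?case
      using vf_apply_chart[where X = X and p = p, OF 2(1) vector_field_tangent[OF X] p]
      by (simp add: conn_fscale_right 2 X) (simp add: fscale_def scaleR_right_diff_distrib)
  qed
qed

section \<open>Christoffel symbols and the coordinate formula\<close>

lemma extends_coord_field_eq:
  "extends_coord_field M i p a X \<Longrightarrow> X p i = a"
  by (auto simp: extends_coord_field_def)

lemma extends_coord_field_dd:
  assumes "extends_coord_field M i p a X"
  shows "dd (\<lambda>x. X (\<psi> i x) i) (\<phi> i p) v = 0"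
proof -
  obtain V where V: "openin (manifold_topology M) V" "p \<in> V" "V \<subseteq> dm i" "\<And>q. q \<in> V \<Longrightarrow> X q i = a"
    using assms by (auto simp: extends_coord_field_def)
  have "dd (\<lambda>x. X (\<psi> i x) i) (\<phi> i p) = dd (\<lambda>x. a) (\<phi> i p)"
    by (rule dd_cong[OF openin_chart[OF V(1)], of _ i]) (use V in auto)
  then show ?thesis by simp
qed

text \<open>Two extensions agree at \<open>p\<close>, which settles the first argument. In the
  second, the coordinate derivatives vanish for both, since extensions are locally constant, and the
  tensorial difference remains.\<close>

lemma conn_extends_unique:
  assumes X: "extends_coord_field M i p a X" and Y: "extends_coord_field M i p b Y"
    and X': "extends_coord_field M i p a X'" and Y': "extends_coord_field M i p b Y'"
  shows "D X Y p i = D X' Y' p i"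
proof -
  have p: "p \<in> dm i" using X by (auto simp: extends_coord_field_def)
  have vf: "vector_field M X" "vector_field M Y" "vector_field M X'" "vector_field M Y'"
    using X Y X' Y' by (auto simp: extends_coord_field_def)
  have eq: "X p = X' p" "Y p = Y' p"
    using X Y X' Y' vf by (auto intro!: tangent_eqI[OF _ _ p] vector_field_tangent simp: extends_coord_field_eq)
  have "D X Y p i = D X' Y p i"
    using tensorial_cong[OF tensorial_conn_left[OF vf(2)] vf(1,3) dom_in_points[OF p] eq(1)] .
  also have "\<dots> = D X' Y' p i"
    using tensorial_cong[OF tensorial_conn_right[OF vf(3) p] vf(2,4) dom_in_points[OF p] eq(2)]
    by (simp add: extends_coord_field_dd[OF Y] extends_coord_field_dd[OF Y'])
  finally show ?thesis .
qed

lemma christoffel_eq: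
  assumes "extends_coord_field M i p a X" "extends_coord_field M i p b Y"
  shows "christoffel M D i p a b = D X Y p i"
  unfolding christoffel_def
proof (rule the_equality)
  show "\<forall>X' Y'. extends_coord_field M i p a X' \<longrightarrow> extends_coord_field M i p b Y' \<longrightarrow> D X' Y' p i = D X Y p i"
    using conn_extends_unique assms by blast
qed (use assms in blast)

text \<open>One family of fields extends the coordinate fields at all points of \<open>U\<close> at
  once, so on \<open>U\<close> the Christoffel symbols are components of a single smooth
  field.\<close>

lemma coord_frame:
  assumes p: "p \<in> dm i"
  obtains E U where "open U" "\<phi> i p \<in> U" "U \<subseteq> im i"
    "\<And>x w. x \<in> U \<Longrightarrow> extends_coord_field M i (\<psi> i x) w (E w)"
proof -
  obtain \<eta> E U where fr: "open U" "\<phi> i p \<in> U" "U \<subseteq> im i" "\<And>x. x \<in> U \<Longrightarrow> \<eta> (\<psi> i x) = 1"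
    "\<And>w. vector_field M (E w)"
    "\<And>w q. q \<in> dm i \<Longrightarrow> E w q i = \<eta> q *\<^sub>R w"
    by (rule local_frame[OF p]) blast
  have "extends_coord_field M i (\<psi> i x) w (E w)" if "x \<in> U" for x w
    unfolding extends_coord_field_def using fr(1,3) that
    by (auto intro!: fr(5) exI[of _ "\<psi> i ` U"] openin_inv_image simp: fr(4) fr(6) subset_iff)
  then show ?thesis using that fr(1-3) by blast
qed

text \<open>The Christoffel symbols as a bilinear map. The second component of
  \<open>horizontal_lift\<close> is minus this form at the field and the fibre coordinate.\<close>

definition christoffel_form :: "'i \<Rightarrow> 'a \<Rightarrow> 'b \<Rightarrow> 'b \<Rightarrow> 'b" where
  "christoffel_form i p v w = (\<Sum>a\<in>Basis. \<Sum>b\<in>Basis. ((v \<bullet> a) * (w \<bullet> b)) *\<^sub>R christoffel M D i p a b)"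

lemma linear_christoffel_form_right: "linear (christoffel_form i p v)"
  unfolding christoffel_form_def
  by (rule linearI) (simp_all add: inner_add_left sum.distrib scaleR_add_left distrib_left
      scaleR_sum_right mult_ac)

text \<open>The frame expands \<open>X\<close> by tensoriality in the first argument and the
  Christoffel part by tensoriality in the second; the coordinate derivative reassembles by
  linearity.\<close>

lemma conn_chart:
  assumes X: "vector_field M X" and Y: "vector_field M Y" and p: "p \<in> dm i"
  shows "D X Y p i = dd (\<lambda>x. Y (\<psi> i x) i) (\<phi> i p) (X p i) + christoffel_form i p (X p i) (Y p i)"
proof -
  obtain E U where E: "\<phi> i p \<in> U" "\<And>x w. x \<in> U \<Longrightarrow> extends_coord_field M i (\<psi> i x) w (E w)"
    by (rule coord_frame[OF p]) blast
  have Ep: "extends_coord_field M i p w (E w)" for w using E(2)[OF E(1)] p by simp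
  have vE: "vector_field M (E w)" for w using Ep by (auto simp: extends_coord_field_def)
  note Ew = extends_coord_field_eq[OF Ep]
  let ?dY = "dd (\<lambda>x. Y (\<psi> i x) i) (\<phi> i p)"
  have lin: "linear ?dY"
    by (intro linear_dd smooth_on_differentiable[OF vector_field_smooth[OF Y]]) (use p in simp)
  have 1: "D (E a) Y p i = ?dY a + (\<Sum>b\<in>Basis. (Y p i \<bullet> b) *\<^sub>R christoffel M D i p a b)" for a
    using tensorial_Basis[OF tensorial_conn_right[OF vE p, of a] Y p, of E, OF vE Ew]
    by (simp add: Ew extends_coord_field_dd[OF Ep] christoffel_eq[OF Ep Ep] algebra_simps)
  have "D X Y p i = (\<Sum>a\<in>Basis. (X p i \<bullet> a) *\<^sub>R D (E a) Y p i)"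
    using tensorial_Basis[OF tensorial_conn_left[OF Y] X p, of E i, OF vE Ew] .
  also have "\<dots> = (\<Sum>a\<in>Basis. (X p i \<bullet> a) *\<^sub>R ?dY a) + christoffel_form i p (X p i) (Y p i)"
    by (simp add: 1 christoffel_form_def scaleR_add_right sum.distrib scaleR_sum_right)
  finally show ?thesis by (simp only: linear_eq_sum_Basis[OF lin, symmetric])
qed

lemma smooth_christoffel: "smooth_on (im i) (\<lambda>x. christoffel M D i (\<psi> i x) a b)"
proof (rule smooth_on_local)
  fix x assume x: "x \<in> im i"
  obtain E U where E: "open U" "\<phi> i (\<psi> i x) \<in> U" "U \<subseteq> im i"
    "\<And>y w. y \<in> U \<Longrightarrow> extends_coord_field M i (\<psi> i y) w (E w)"
    by (rule coord_frame[OF inv_in_dom[OF x]]) blast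
  have vE: "vector_field M (E w)" for w using E(2,4) by (auto simp: extends_coord_field_def)
  have "smooth_on U (\<lambda>y. D (E a) (E b) (\<psi> i y) i)"
    using smooth_on_subset[OF vector_field_smooth[OF conn_vector_field[OF vE vE]] E(3)] .
  then have "smooth_on U (\<lambda>y. christoffel M D i (\<psi> i y) a b)"
    by (rule smooth_on_cong[OF E(1), THEN iffD1, rotated]) (simp add: christoffel_eq[OF E(4) E(4)])
  then show "\<exists>U. open U \<and> x \<in> U \<and> smooth_on U (\<lambda>y. christoffel M D i (\<psi> i y) a b)"
    using E(1,2) x by auto
qed

lemma smooth_christoffel_form:
  assumes "open S" "smooth_on S g" "g ` S \<subseteq> im i" "smooth_on S v" "smooth_on S w"
  shows "smooth_on S (\<lambda>z. christoffel_form i (\<psi> i (g z)) (v z) (w z))"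
  unfolding christoffel_form_def
  by (intro smooth_on_sum smooth_on_scaleR smooth_on_mult smooth_on_inner_left assms
      smooth_on_compose[OF assms(1,2) smooth_christoffel assms(3)])

end

section \<open>The tangent bundle as a manifold\<close>

lemma tangent_bundle_dom:
  "u \<in> chart_dom (tangent_bundle M) i \<longleftrightarrow> fst u \<in> chart_dom M i \<and> snd u \<in> tangent_space M (fst u)"
  by (cases u) (simp add: tangent_bundle_def)

lemma tangent_bundle_map: "chart_map (tangent_bundle M) i u = (chart_map M i (fst u), snd u i)"
  by (cases u) (simp add: tangent_bundle_def)

lemma tangent_bundle_points:
  "u \<in> points (tangent_bundle M) \<longleftrightarrow> fst u \<in> points M \<and> snd u \<in> tangent_space M (fst u)"
  by (auto simp: points_iff tangent_bundle_dom)

context charted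
begin

abbreviation "TM \<equiv> tangent_bundle M"

lemma TM_inj: "inj_on (chart_map TM i) (chart_dom TM i)"
proof (rule inj_onI)
  fix u u' assume u: "u \<in> chart_dom TM i" "u' \<in> chart_dom TM i" "chart_map TM i u = chart_map TM i u'"
  then have "fst u = fst u'" using inj_onD[OF inj] by (auto simp: tangent_bundle_dom tangent_bundle_map)
  then show "u = u'" using u tangent_eqI[of "snd u" "fst u" "snd u'" i]
    by (auto simp: tangent_bundle_dom tangent_bundle_map prod_eq_iff)
qed

text \<open>Unions of full fibres become products with the whole model space, because
  \<open>coord_vector\<close> realises every fibre coordinate. This covers chart domains and
  preimages under the projection.\<close>

lemma TM_map_image:
  assumes "\<And>u. u \<in> V \<longleftrightarrow> u \<in> points TM \<and> fst u \<in> W"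
  shows "chart_map TM i ` (V \<inter> chart_dom TM i) = \<phi> i ` (W \<inter> dm i) \<times> (UNIV :: 'b set)"
proof (intro set_eqI iffI)
  fix z assume "z \<in> \<phi> i ` (W \<inter> dm i) \<times> (UNIV :: 'b set)"
  then obtain p where p: "p \<in> W" "p \<in> dm i" "fst z = \<phi> i p" by auto
  have "(p, coord_vector i p (snd z)) \<in> V \<inter> chart_dom TM i"
    using p by (auto simp: assms tangent_bundle_dom tangent_bundle_points coord_vector_tangent dom_in_points)
  moreover have "z = chart_map TM i (p, coord_vector i p (snd z))"
    using p by (simp add: tangent_bundle_map coord_vector_self prod_eq_iff)
  ultimately show "z \<in> chart_map TM i ` (V \<inter> chart_dom TM i)" by blast
qed (auto simp: assms tangent_bundle_dom tangent_bundle_map)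

lemma TM_overlap:
  "chart_map TM i ` (chart_dom TM i \<inter> chart_dom TM j) = overlap i j \<times> UNIV"
proof -
  have "chart_map TM i ` (chart_dom TM j \<inter> chart_dom TM i) = \<phi> i ` (dm j \<inter> dm i) \<times> UNIV"
    by (rule TM_map_image) (auto simp: tangent_bundle_dom tangent_bundle_points dom_in_points)
  then show ?thesis by (simp add: overlap_def Int_commute)
qed

lemma TM_img: "chart_img TM i = im i \<times> UNIV"
  using TM_overlap[of i i] by (simp add: chart_img_def overlap_def)

lemma TM_inv: "x \<in> im i \<Longrightarrow> chart_inv TM i (x, w) = (\<psi> i x, coord_vector i (\<psi> i x) w)"
  unfolding chart_inv_def[of TM]
  by (rule inv_into_f_eq[OF TM_inj])
    (simp_all add: tangent_bundle_dom tangent_bundle_map coord_vector_tangent coord_vector_self)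

lemma TM_transition:
  "z \<in> overlap i j \<times> UNIV \<Longrightarrow> transition TM i j z = (\<tau> i j (fst z), dd (\<tau> i j) (fst z) (snd z))"
  by (cases z) (auto simp: transition_def[of TM] TM_inv tangent_bundle_map overlap_iff transition_eq coord_vector_def)

lemma charted_TM: "charted TM"
proof
  show "open (chart_img TM i)" for i
    by (simp add: TM_img open_img open_Times)
  show "open (chart_map TM i ` (chart_dom TM i \<inter> chart_dom TM j))" for i j
    by (simp add: TM_overlap open_overlap open_Times)
  show "smooth_on (chart_map TM i ` (chart_dom TM i \<inter> chart_dom TM j)) (transition TM i j)" for i j
  proof -
    let ?S = "overlap i j \<times> (UNIV :: 'b set)"
    have S: "open ?S" by (simp add: open_overlap open_Times)
    note fs = smooth_on_fst[OF S smooth_on_ident] smooth_on_snd[OF S smooth_on_ident]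
    have sub: "fst ` ?S \<subseteq> overlap i j" by auto
    have "smooth_on ?S (\<lambda>z. (\<tau> i j (fst z), dd (\<tau> i j) (fst z) (snd z)))"
      by (rule smooth_on_Pair[OF S smooth_on_compose[OF S fs(1) smooth_transition sub]
            smooth_on_dd_apply[OF S smooth_transition fs sub]])
    then show ?thesis
      unfolding TM_overlap by (rule smooth_on_cong[OF S, THEN iffD1, rotated]) (simp add: TM_transition)
  qed
qed (rule TM_inj)

end

context manifold
begin

text \<open>Those members of a countable basis that lie in a chart already cover \<open>M\<close>;
  each is assigned one such chart. Members lying in no chart get an arbitrary index, which does no
  harm.\<close>

lemma countable_chart_cover: "\<exists>I. countable I \<and> points M \<subseteq> (\<Union>i\<in>I. dm i)"
proof -
  obtain B where B: "countable B" "\<And>U p. openin (manifold_topology M) U \<Longrightarrow> p \<in> U \<Longrightarrow> \<exists>V\<in>B. p \<in> V \<and> V \<subseteq> U"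
    using smooth_manifold unfolding smooth_manifold_def second_countable_def by metis
  define c where "c V = (SOME i. V \<subseteq> dm i)" for V
  have "points M \<subseteq> (\<Union>i\<in>c ` B. dm i)"
  proof
    fix p assume "p \<in> points M"
    then obtain i where i: "p \<in> dm i" by (auto simp: points_iff)
    have "openin (manifold_topology M) (dm i)"
      using open_overlap_raw[of _ i] by (auto simp: openin_iff dom_in_points Int_commute)
    then obtain V where V: "V \<in> B" "p \<in> V" "V \<subseteq> dm i" using B(2) i by blast
    then have "V \<subseteq> dm (c V)" unfolding c_def by (intro someI)
    then show "p \<in> (\<Union>i\<in>c ` B. dm i)" using V by auto
  qed
  then show ?thesis using B(1) by blast
qed

text \<open>Vectors over different points are separated by preimages under the projection. Vectors
  over the same point lie in a common chart and are separated in the model space.\<close>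

lemma Hausdorff_TM: "Hausdorff_space (manifold_topology TM)"
proof -
  interpret T: charted TM by (rule charted_TM)
  show ?thesis
    unfolding Hausdorff_space_def T.topspace_eq
  proof (intro allI impI, elim conjE)
    fix u u' assume u: "u \<in> points TM" "u' \<in> points TM" "u \<noteq> u'"
    show "\<exists>U V. openin (manifold_topology TM) U \<and> openin (manifold_topology TM) V \<and> u \<in> U \<and> u' \<in> V \<and> disjnt U V"
    proof (cases "fst u = fst u'")
      case False
      obtain U V where UV: "openin (manifold_topology M) U" "openin (manifold_topology M) V"
        "fst u \<in> U" "fst u' \<in> V" "disjnt U V"
        using smooth_manifold False u unfolding smooth_manifold_def Hausdorff_space_def topspace_eq
        by (metis tangent_bundle_points)
      have "openin (manifold_topology TM) {z \<in> points TM. fst z \<in> W}"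
        if "openin (manifold_topology M) W" for W
        using openin_chart[OF that] unfolding T.openin_iff
        by (subst TM_map_image[of _ W]) (auto simp: open_Times)
      then show ?thesis using UV u
        by (intro exI[of _ "{z \<in> points TM. fst z \<in> U}"] exI[of _ "{z \<in> points TM. fst z \<in> V}"])
          (auto simp: disjnt_iff)
    next
      case True
      obtain i where i: "u \<in> chart_dom TM i" using u by (auto simp: points_iff)
      then have i': "u' \<in> chart_dom TM i" using u True by (simp add: tangent_bundle_dom tangent_bundle_points)
      have "T.\<phi> i u \<noteq> T.\<phi> i u'" using inj_onD[OF T.inj _ i i'] u(3) by blast
      then obtain A B where AB: "open A" "open B" "T.\<phi> i u \<in> A" "T.\<phi> i u' \<in> B" "A \<inter> B = {}"
        using hausdorff by metis
      let ?N = "\<lambda>A. T.\<psi> i ` (A \<inter> T.im i)"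
      have mem: "z \<in> ?N A" if "z \<in> chart_dom TM i" "T.\<phi> i z \<in> A" for z A
        using that by (intro image_eqI[of _ _ "T.\<phi> i z"]) auto
      have "?N A \<inter> ?N B = {}"
      proof (intro equals0I)
        fix z assume "z \<in> ?N A \<inter> ?N B"
        then have "T.\<phi> i z \<in> A \<inter> B" using T.map_inv by (metis (no_types, lifting) IntE IntI imageE)
        then show False using AB(5) by simp
      qed
      then show ?thesis using AB T.open_img mem[OF i AB(3)] mem[OF i' AB(4)]
        by (intro exI[of _ "?N A"] exI[of _ "?N B"] conjI T.openin_inv_image) (auto simp: disjnt_def)
    qed
  qed
qed

lemma smooth_manifold_TM: "smooth_manifold TM"
proof -
  interpret T: charted TM by (rule charted_TM)
  obtain I where I: "countable I" "points M \<subseteq> (\<Union>i\<in>I. dm i)" using countable_chart_cover by blast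
  have "points TM \<subseteq> (\<Union>i\<in>I. chart_dom TM i)"
    using I(2) by (fastforce simp: tangent_bundle_points tangent_bundle_dom)
  then have "second_countable (manifold_topology TM)" using I(1) by (intro T.second_countable_of_cover)
  then show ?thesis unfolding smooth_manifold_def
    using Hausdorff_TM T.inj T.open_img T.open_overlap_raw T.smooth_transition_raw by blast
qed

end

text \<open>Attached to \<open>affine_manifold\<close>, since the same inclusion for
  \<open>manifold\<close> would apply to its own result and run through all iterated tangent
  bundles.\<close>

sublocale affine_manifold \<subseteq> T: manifold "tangent_bundle M"
  by unfold_locales (rule smooth_manifold_TM)

section \<open>Lifts and their brackets\<close>

context affine_manifold
begin

abbreviation "VL \<equiv> vertical_lift M"
abbreviation "HL \<equiv> horizontal_lift M D"

lemma vertical_lift_chart: "u \<in> T.dm i \<Longrightarrow> VL X u i = (0, X (fst u) i)"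
  by (simp add: vertical_lift_def)

lemma horizontal_lift_chart:
  "u \<in> T.dm i \<Longrightarrow> HL X u i = (X (fst u) i, - christoffel_form i (fst u) (X (fst u) i) (snd u i))"
  by (simp add: horizontal_lift_def christoffel_form_def)

lemma TM_inv_components:
  assumes "z \<in> im i \<times> UNIV"
  shows "fst (T.\<psi> i z) = \<psi> i (fst z)" "snd (T.\<psi> i z) i = snd z" "T.\<psi> i z \<in> T.dm i"
  using assms TM_inv[of "fst z" i "snd z"]
  by (auto simp: coord_vector_self tangent_bundle_dom coord_vector_tangent)

lemma vertical_lift_inv:
  "z \<in> im i \<times> UNIV \<Longrightarrow> VL X (T.\<psi> i z) i = (0, X (\<psi> i (fst z)) i)"
  by (simp add: vertical_lift_chart TM_inv_components)

lemma horizontal_lift_inv: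
  "z \<in> im i \<times> UNIV \<Longrightarrow> HL X (T.\<psi> i z) i =
     (X (\<psi> i (fst z)) i, - christoffel_form i (\<psi> i (fst z)) (X (\<psi> i (fst z)) i) (snd z))"
  by (simp add: horizontal_lift_chart TM_inv_components)

lemma open_TM_img: "open (im i \<times> (UNIV :: 'b set))"
  by (simp add: open_img open_Times)

lemma smooth_on_compose_fst:
  assumes "smooth_on (im i) f"
  shows "smooth_on (im i \<times> (UNIV :: 'b set)) (\<lambda>z. f (fst z))"
  by (rule smooth_on_compose[OF open_TM_img smooth_on_fst[OF open_TM_img smooth_on_ident] assms]) auto

text \<open>A block triangular derivative: the off-diagonal block is the second derivative of
  \<open>\<tau> i j\<close> contracted with the fibre coordinate. Vertical vectors, with
  \<open>a = 0\<close>, do not feel it; horizontal lifts must compensate for it.\<close>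

lemma dd_TM_transition:
  assumes "x \<in> overlap i j"
  shows "dd (transition TM i j) (x, w) (a, b)
    = (dd (\<tau> i j) x a, dd (\<lambda>y. dd (\<tau> i j) y w) x a + dd (\<tau> i j) x b)"
proof -
  let ?S = "overlap i j \<times> (UNIV :: 'b set)"
  have S: "open ?S" "(x, w) \<in> ?S" using assms by (simp_all add: open_overlap open_Times)
  have 1: "((\<lambda>z. \<tau> i j (fst z)) has_derivative (\<lambda>c. dd (\<tau> i j) x (fst c))) (at (x, w))"
    using has_derivative_compose[OF has_derivative_fst[OF has_derivative_ident], of "\<tau> i j" _ "(x, w)" UNIV]
      smooth_on_has_derivative[OF smooth_transition assms] by simp
  have d: "fst differentiable (at (x, w))" "snd differentiable (at (x, w))"
    by (auto simp: differentiable_def intro: has_derivative_fst[OF has_derivative_ident]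
        has_derivative_snd[OF has_derivative_ident])
  have e: "dd fst (x, w) = fst" "dd snd (x, w) = snd"
    by (auto intro!: dd_eqI has_derivative_fst[OF has_derivative_ident] has_derivative_snd[OF has_derivative_ident])
  have 2: "((\<lambda>z. dd (\<tau> i j) (fst z) (snd z)) has_derivative
      (\<lambda>c. dd (\<lambda>y. dd (\<tau> i j) y w) x (fst c) + dd (\<tau> i j) x (snd c))) (at (x, w))"
    using dd_dd_apply[where g = fst and v = snd, OF smooth_transition d open_overlap, of i j] assms by (simp add: e)
  have "dd (transition TM i j) (x, w) = dd (\<lambda>z. (\<tau> i j (fst z), dd (\<tau> i j) (fst z) (snd z))) (x, w)"
    by (rule dd_cong[OF S]) (simp add: TM_transition)
  then show ?thesis using has_derivative_Pair[OF 1 2, THEN dd_eqI] by simp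
qed

lemma vector_field_vertical_lift:
  assumes X: "vector_field M X"
  shows "vector_field TM (VL X)"
  unfolding vector_field_def TM_img
proof (intro conjI allI)
  fix u
  show "VL X u \<in> tangent_space TM u"
  proof (rule T.tangentI)
    fix i j assume u: "u \<in> T.dm i" "u \<in> T.dm j"
    then have p: "fst u \<in> dm i" "fst u \<in> dm j" by (auto simp: tangent_bundle_dom)
    then show "VL X u j = dd (T.\<tau> i j) (T.\<phi> i u) (VL X u i)"
      using tangent_transition[OF vector_field_tangent[OF X] p]
      by (simp add: vertical_lift_chart u tangent_bundle_map dd_TM_transition linear_0 linear_dd
          smooth_on_differentiable[OF smooth_on_dd[OF smooth_transition]] linear_dd_transition)
  qed (simp add: vertical_lift_def)
next
  fix i
  have "smooth_on (im i \<times> (UNIV :: 'b set)) (\<lambda>z. (0 :: 'b, X (\<psi> i (fst z)) i))"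
    by (intro smooth_on_Pair open_TM_img smooth_on_const smooth_on_compose_fst[OF vector_field_smooth[OF X]])
  then show "smooth_on (im i \<times> UNIV) (\<lambda>z. VL X (T.\<psi> i z) i)"
    by (rule smooth_on_cong[OF open_TM_img, THEN iffD1, rotated]) (simp add: vertical_lift_inv)
qed

text \<open>The transformation law is read off from \<open>\<Gamma>(x, v) = D\<^sub>X Z - dZ(X)\<close> for any fields \<open>X\<close>, \<open>Z\<close>
  through \<open>x\<close> and \<open>v\<close>.\<close>

lemma christoffel_form_transition:
  assumes p: "p \<in> dm i" "p \<in> dm j" and x: "x \<in> tangent_space M p" and v: "v \<in> tangent_space M p"
  shows "christoffel_form j p (x j) (v j) = dd (\<tau> i j) (\<phi> i p) (christoffel_form i p (x i) (v i))
    - dd (\<lambda>y. dd (\<tau> i j) y (v i)) (\<phi> i p) (x i)"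
proof -
  obtain X where X: "vector_field M X" "X p = x" by (rule extend_tangent[OF x])
  obtain Z where Z: "vector_field M Z" "Z p = v" by (rule extend_tangent[OF v])
  have o: "\<phi> i p \<in> overlap i j" and t: "\<tau> i j (\<phi> i p) = \<phi> j p" using p by (simp_all add: transition_eq)
  have d: "(\<lambda>y. Z (\<psi> k y) k) differentiable (at (\<phi> k p))" if "p \<in> dm k" for k
    using that by (intro smooth_on_differentiable[OF vector_field_smooth[OF Z(1)]]) simp
  have "dd (\<lambda>y. Z (\<psi> j y) j) (\<phi> j p) (x j) = dd (\<lambda>y. Z (\<psi> j (\<tau> i j y)) j) (\<phi> i p) (x i)"
    using dd_compose[OF transition_differentiable[OF o], of "\<lambda>y. Z (\<psi> j y) j" "x i"] t d[OF p(2)]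
      tangent_transition[OF x p] by simp
  also have "dd (\<lambda>y. Z (\<psi> j (\<tau> i j y)) j) (\<phi> i p) = dd (\<lambda>y. dd (\<tau> i j) y (Z (\<psi> i y) i)) (\<phi> i p)"
    by (rule dd_cong[OF open_overlap o]) (simp add: vector_field_transition[OF Z(1)])
  also have "\<dots> (x i) = dd (\<lambda>y. dd (\<tau> i j) y (v i)) (\<phi> i p) (x i)
      + dd (\<tau> i j) (\<phi> i p) (dd (\<lambda>y. Z (\<psi> i y) i) (\<phi> i p) (x i))"
    using dd_dd_apply[where g = "\<lambda>y. y", OF smooth_transition _ d[OF p(1)] open_overlap o, THEN dd_eqI] p Z
    by simp
  finally have 1: "dd (\<lambda>y. Z (\<psi> j y) j) (\<phi> j p) (x j) = dd (\<lambda>y. dd (\<tau> i j) y (v i)) (\<phi> i p) (x i)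
      + dd (\<tau> i j) (\<phi> i p) (dd (\<lambda>y. Z (\<psi> i y) i) (\<phi> i p) (x i))" .
  have "D X Z p j = dd (\<tau> i j) (\<phi> i p) (D X Z p i)"
    by (rule tangent_transition[OF vector_field_tangent[OF conn_vector_field[OF X(1) Z(1)]] p])
  then show ?thesis
    using 1 by (simp add: conn_chart[OF X(1) Z(1)] p X Z linear_add[OF linear_dd_transition[OF p]] algebra_simps)
qed

text \<open>The inhomogeneous term in the change of the Christoffel form is exactly the
  second-derivative block of the transition map of \<open>TM\<close>.\<close>

lemma vector_field_horizontal_lift:
  assumes X: "vector_field M X"
  shows "vector_field TM (HL X)"
  unfolding vector_field_def TM_img
proof (intro conjI allI)
  fix u
  show "HL X u \<in> tangent_space TM u"
  proof (rule T.tangentI)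
    fix i j assume u: "u \<in> T.dm i" "u \<in> T.dm j"
    then have p: "fst u \<in> dm i" "fst u \<in> dm j" and v: "snd u \<in> tangent_space M (fst u)"
      by (auto simp: tangent_bundle_dom)
    show "HL X u j = dd (T.\<tau> i j) (T.\<phi> i u) (HL X u i)"
      using christoffel_form_transition[OF p vector_field_tangent[OF X] v]
        tangent_transition[OF vector_field_tangent[OF X] p] p
      by (simp add: horizontal_lift_chart u tangent_bundle_map dd_TM_transition
          linear_neg[OF linear_dd_transition[OF p]])
  qed (simp add: horizontal_lift_def)
next
  fix i
  have X': "smooth_on (im i \<times> (UNIV :: 'b set)) (\<lambda>z. X (\<psi> i (fst z)) i)"
    by (rule smooth_on_compose_fst[OF vector_field_smooth[OF X]])
  have "smooth_on (im i \<times> (UNIV :: 'b set)) (\<lambda>z. (X (\<psi> i (fst z)) i, - christoffel_form i (\<psi> i (fst z)) (X (\<psi> i (fst z)) i) (snd z)))"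
    by (intro smooth_on_Pair smooth_on_uminus smooth_christoffel_form open_TM_img X'
        smooth_on_fst[OF open_TM_img smooth_on_ident] smooth_on_snd[OF open_TM_img smooth_on_ident]) auto
  then show "smooth_on (im i \<times> UNIV) (\<lambda>z. HL X (T.\<psi> i z) i)"
    by (rule smooth_on_cong[OF open_TM_img, THEN iffD1, rotated]) (simp add: horizontal_lift_inv)
qed

section \<open>Brackets of lifts\<close>

lemma dd_vertical_lift:
  assumes X: "vector_field M X" and u: "u \<in> T.dm i"
  shows "dd (\<lambda>z. VL X (T.\<psi> i z) i) (T.\<phi> i u) c = (0, dd (\<lambda>x. X (\<psi> i x) i) (\<phi> i (fst u)) (fst c))"
proof -
  have p: "fst u \<in> dm i" using u by (simp add: tangent_bundle_dom)
  have z: "T.\<phi> i u \<in> im i \<times> UNIV" using p by (simp add: tangent_bundle_map)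
  have "((\<lambda>z. X (\<psi> i (fst z)) i) has_derivative (\<lambda>c. dd (\<lambda>x. X (\<psi> i x) i) (\<phi> i (fst u)) (fst c))) (at (T.\<phi> i u))"
    by (rule has_derivative_compose[OF has_derivative_fst[OF has_derivative_ident]])
      (use p in \<open>simp add: tangent_bundle_map smooth_on_has_derivative[OF vector_field_smooth[OF X]]\<close>)
  from has_derivative_Pair[OF has_derivative_const[of "0 :: 'b"] this, THEN dd_eqI]
  have "dd (\<lambda>z. (0 :: 'b, X (\<psi> i (fst z)) i)) (T.\<phi> i u) c
      = (0, dd (\<lambda>x. X (\<psi> i x) i) (\<phi> i (fst u)) (fst c))" by simp
  moreover have "dd (\<lambda>z. VL X (T.\<psi> i z) i) (T.\<phi> i u) = dd (\<lambda>z. (0 :: 'b, X (\<psi> i (fst z)) i)) (T.\<phi> i u)"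
    by (rule dd_cong[OF open_TM_img z]) (simp add: vertical_lift_inv)
  ultimately show ?thesis by simp
qed

text \<open>The fibre variable enters linearly: its increment \<open>snd c\<close> just replaces it
  in the Christoffel form, while the base increment differentiates the form with the fibre value
  frozen at \<open>snd u i\<close>.\<close>

lemma dd_horizontal_lift:
  assumes X: "vector_field M X" and u: "u \<in> T.dm i"
  shows "dd (\<lambda>z. HL X (T.\<psi> i z) i) (T.\<phi> i u) c =
    (dd (\<lambda>x. X (\<psi> i x) i) (\<phi> i (fst u)) (fst c),
     - (dd (\<lambda>x. christoffel_form i (\<psi> i x) (X (\<psi> i x) i) (snd u i)) (\<phi> i (fst u)) (fst c)
        + christoffel_form i (fst u) (X (fst u) i) (snd c)))"
proof -
  have p: "fst u \<in> dm i" using u by (simp add: tangent_bundle_dom)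
  have z: "T.\<phi> i u \<in> im i \<times> UNIV" using p by (simp add: tangent_bundle_map)
  have 1: "((\<lambda>z. X (\<psi> i (fst z)) i) has_derivative (\<lambda>c. dd (\<lambda>x. X (\<psi> i x) i) (\<phi> i (fst u)) (fst c))) (at (T.\<phi> i u))"
    by (rule has_derivative_compose[OF has_derivative_fst[OF has_derivative_ident]])
      (use p in \<open>simp add: tangent_bundle_map smooth_on_has_derivative[OF vector_field_smooth[OF X]]\<close>)
  have d: "(fst :: 'b \<times> 'b \<Rightarrow> 'b) differentiable (at q)" "(snd :: 'b \<times> 'b \<Rightarrow> 'b) differentiable (at q)" for q
    by (auto simp: differentiable_def intro: has_derivative_fst[OF has_derivative_ident]
        has_derivative_snd[OF has_derivative_ident])
  have e: "dd (fst :: 'b \<times> 'b \<Rightarrow> 'b) q = fst" "dd (snd :: 'b \<times> 'b \<Rightarrow> 'b) q = snd" for q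
    by (auto intro!: dd_eqI has_derivative_fst[OF has_derivative_ident] has_derivative_snd[OF has_derivative_ident])
  have g: "(\<lambda>x. christoffel_form i (\<psi> i x) (X (\<psi> i x) i) b) differentiable (at (fst (T.\<phi> i u)))" for b
    by (rule smooth_on_differentiable[of "im i"],
        intro smooth_christoffel_form open_img smooth_on_ident smooth_on_const vector_field_smooth X)
      (use p in \<open>auto simp: tangent_bundle_map\<close>)
  have 2: "((\<lambda>z. christoffel_form i (\<psi> i (fst z)) (X (\<psi> i (fst z)) i) (snd z)) has_derivative
      (\<lambda>c. dd (\<lambda>x. christoffel_form i (\<psi> i x) (X (\<psi> i x) i) (snd u i)) (\<phi> i (fst u)) (fst c)
        + christoffel_form i (fst u) (X (fst u) i) (snd c))) (at (T.\<phi> i u))"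
    using has_derivative_linear_family[where F = "\<lambda>x. christoffel_form i (\<psi> i x) (X (\<psi> i x) i)" and g = fst and v = snd,
        OF linear_christoffel_form_right g d open_UNIV UNIV_I] p
    by (simp add: e tangent_bundle_map)
  have "dd (\<lambda>z. HL X (T.\<psi> i z) i) (T.\<phi> i u)
      = dd (\<lambda>z. (X (\<psi> i (fst z)) i, - christoffel_form i (\<psi> i (fst z)) (X (\<psi> i (fst z)) i) (snd z))) (T.\<phi> i u)"
    by (rule dd_cong[OF open_TM_img z]) (simp add: horizontal_lift_inv)
  then show ?thesis using has_derivative_Pair[OF 1 has_derivative_minus[OF 2], THEN dd_eqI] by simp
qed

lemma linear_dd_vector_field:
  "vector_field M X \<Longrightarrow> p \<in> dm i \<Longrightarrow> linear (dd (\<lambda>x. X (\<psi> i x) i) (\<phi> i p))"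
  by (intro linear_dd smooth_on_differentiable[OF vector_field_smooth]) simp_all

lemma linear_dd_christoffel_form:
  assumes "vector_field M X" "p \<in> dm i"
  shows "linear (dd (\<lambda>x. christoffel_form i (\<psi> i x) (X (\<psi> i x) i) w) (\<phi> i p))"
  by (rule linear_dd, rule smooth_on_differentiable[of "im i"],
      intro smooth_christoffel_form open_img smooth_on_ident smooth_on_const vector_field_smooth assms)
    (use assms in auto)

lemma lie_bracket_VV:
  assumes X: "vector_field M X" and Y: "vector_field M Y"
  shows "lie_bracket TM (VL X) (VL Y) u = 0"
proof
  fix i
  show "lie_bracket TM (VL X) (VL Y) u i = 0 i"
  proof (cases "u \<in> T.dm i")
    case True
    then have "fst u \<in> dm i" by (simp add: tangent_bundle_dom)
    then show ?thesis using True
      by (simp add: T.lie_bracket_chart dd_vertical_lift X Y vertical_lift_chart linear_0 linear_dd_vector_field)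
  qed (simp add: lie_bracket_def)
qed

text \<open>The coordinate derivative of \<open>Y\<close> along \<open>X\<close> is one term of
  \<open>conn_chart\<close>; the fibre derivative of \<open>HL X\<close> along \<open>VL Y\<close>
  supplies the Christoffel term.\<close>

lemma lie_bracket_HV:
  assumes X: "vector_field M X" and Y: "vector_field M Y"
  shows "lie_bracket TM (HL X) (VL Y) u = VL (D X Y) u"
proof
  fix i
  show "lie_bracket TM (HL X) (VL Y) u i = VL (D X Y) u i"
  proof (cases "u \<in> T.dm i")
    case True
    then have "fst u \<in> dm i" by (simp add: tangent_bundle_dom)
    then show ?thesis using True
      by (simp add: T.lie_bracket_chart dd_vertical_lift dd_horizontal_lift X Y vertical_lift_chart
          horizontal_lift_chart linear_0 linear_dd_vector_field linear_dd_christoffel_form conn_chart)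
  qed (simp add: lie_bracket_def vertical_lift_def)
qed

text \<open>The vertical parts add up to minus the commutator of covariant derivatives along
  \<open>X\<close> and \<open>Y\<close>, applied to a field with constant components near the base
  point. Vanishing curvature turns this into the Christoffel form at the bracket.\<close>

lemma lie_bracket_HH:
  assumes flat: "flat_connection M D" and X: "vector_field M X" and Y: "vector_field M Y"
  shows "lie_bracket TM (HL X) (HL Y) u = HL (lie_bracket M X Y) u"
proof
  fix i
  show "lie_bracket TM (HL X) (HL Y) u i = HL (lie_bracket M X Y) u i"
  proof (cases "u \<in> T.dm i")
    case True
    then have p: "fst u \<in> dm i" by (simp add: tangent_bundle_dom)
    let ?p = "fst u" and ?w = "snd u i"
    obtain E U where E: "open U" "\<phi> i ?p \<in> U" "U \<subseteq> im i"
      "\<And>x w. x \<in> U \<Longrightarrow> extends_coord_field M i (\<psi> i x) w (E w)"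
      by (rule coord_frame[OF p]) blast
    \<comment> \<open>Equal to the fibre value \<open>?w\<close> on a whole neighbourhood, so
      \<open>D A Z\<close> is the Christoffel form there and can be differentiated once
      more.\<close>
    define Z where "Z = E ?w"
    have ext: "extends_coord_field M i (\<psi> i x) ?w Z" if "x \<in> U" for x
      using E(4)[OF that] by (simp add: Z_def)
    have Z: "vector_field M Z" using ext[OF E(2)] by (auto simp: extends_coord_field_def)
    have DZ: "D A Z (\<psi> i x) i = christoffel_form i (\<psi> i x) (A (\<psi> i x) i) ?w" if "vector_field M A" "x \<in> U" for A x
      using conn_chart[OF that(1) Z, of "\<psi> i x" i] that(2) E(3) extends_coord_field_dd[OF ext]
        extends_coord_field_eq[OF ext[OF that(2)]] by (auto simp: subset_iff)
    have DZp: "D A Z ?p i = christoffel_form i ?p (A ?p i) ?w" if "vector_field M A" for A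
      using DZ[OF that E(2)] p by simp
    have ddDZ: "dd (\<lambda>x. D A Z (\<psi> i x) i) (\<phi> i ?p) = dd (\<lambda>x. christoffel_form i (\<psi> i x) (A (\<psi> i x) i) ?w) (\<phi> i ?p)"
      if "vector_field M A" for A
      by (rule dd_cong[OF E(1,2)]) (rule DZ[OF that])
    have DDZ: "D A (D B Z) ?p i = dd (\<lambda>x. christoffel_form i (\<psi> i x) (B (\<psi> i x) i) ?w) (\<phi> i ?p) (A ?p i)
        + christoffel_form i ?p (A ?p i) (christoffel_form i ?p (B ?p i) ?w)" if "vector_field M A" "vector_field M B" for A B
      using that by (simp add: conn_chart[OF that(1) conn_vector_field[OF that(2) Z] p] ddDZ DZp)
    have "curvature M D X Y Z ?p i = 0"
      using flat X Y Z by (simp add: flat_connection_def)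
    then have "christoffel_form i ?p (lie_bracket M X Y ?p i) ?w = D X (D Y Z) ?p i - D Y (D X Z) ?p i"
      by (simp add: curvature_def DZp[OF vector_field_lie_bracket[OF X Y]])
    then show ?thesis using True p
      by (simp add: T.lie_bracket_chart dd_horizontal_lift X Y horizontal_lift_chart DDZ
          linear_neg[OF linear_christoffel_form_right] lie_bracket_chart)
  qed (simp add: lie_bracket_def horizontal_lift_def)
qed

section \<open>Functions pulled back from the base, and decomposition into lifts\<close>

lemma smooth_fun_fst:
  assumes "smooth_fun M f"
  shows "smooth_fun TM (\<lambda>u. f (fst u))"
  unfolding smooth_fun_def TM_img o_def
proof
  fix i
  have "smooth_on (im i \<times> (UNIV :: 'b set)) (\<lambda>z. f (\<psi> i (fst z)))"
    by (rule smooth_on_compose_fst[OF smooth_fun_smooth[OF assms]])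
  then show "smooth_on (im i \<times> UNIV) (\<lambda>z. f (fst (T.\<psi> i z)))"
    by (rule smooth_on_cong[OF open_TM_img, THEN iffD1, rotated]) (simp add: TM_inv_components)
qed

lemma vf_apply_fst:
  assumes f: "smooth_fun M f" and W: "vector_field TM W" and u: "u \<in> T.dm i"
  shows "vf_apply TM W (\<lambda>u. f (fst u)) u = dd (\<lambda>x. f (\<psi> i x)) (\<phi> i (fst u)) (fst (W u i))"
proof -
  have p: "fst u \<in> dm i" using u by (simp add: tangent_bundle_dom)
  have z: "T.\<phi> i u \<in> im i \<times> UNIV" using p by (simp add: tangent_bundle_map)
  have "((\<lambda>z. f (\<psi> i (fst z))) has_derivative (\<lambda>c. dd (\<lambda>x. f (\<psi> i x)) (\<phi> i (fst u)) (fst c))) (at (T.\<phi> i u))"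
    by (rule has_derivative_compose[OF has_derivative_fst[OF has_derivative_ident]])
      (use p in \<open>simp add: tangent_bundle_map smooth_on_has_derivative[OF smooth_fun_smooth[OF f]]\<close>)
  moreover have "dd (\<lambda>z. f (fst (T.\<psi> i z))) (T.\<phi> i u) = dd (\<lambda>z. f (\<psi> i (fst z))) (T.\<phi> i u)"
    by (rule dd_cong[OF open_TM_img z]) (simp add: TM_inv_components)
  ultimately show ?thesis
    using T.vf_apply_chart[where X = W and p = u, OF smooth_fun_fst[OF f] T.vector_field_tangent[OF W] u]
    by (simp add: dd_eqI)
qed

lemma vf_apply_horizontal_lift:
  assumes f: "smooth_fun M f" and X: "vector_field M X" and u: "u \<in> points TM"
  shows "vf_apply TM (HL X) (\<lambda>u. f (fst u)) u = vf_apply M X f (fst u)"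
proof -
  obtain i where i: "u \<in> T.dm i" using u by (auto simp: points_iff)
  then show ?thesis
    using vf_apply_chart[where X = X and p = "fst u" and i = i, OF f vector_field_tangent[OF X]]
    by (simp add: vf_apply_fst[OF f vector_field_horizontal_lift[OF X] i] horizontal_lift_chart
        tangent_bundle_dom)
qed

lemma vf_apply_vertical_lift:
  assumes f: "smooth_fun M f" and X: "vector_field M X" and u: "u \<in> points TM"
  shows "vf_apply TM (VL X) (\<lambda>u. f (fst u)) u = 0"
proof -
  obtain i where i: "u \<in> T.dm i" using u by (auto simp: points_iff)
  then have p: "\<phi> i (fst u) \<in> im i" by (simp add: tangent_bundle_dom)
  show ?thesis
    using linear_0[OF linear_dd[OF smooth_on_differentiable[OF smooth_fun_smooth[OF f] p]]]
    by (simp add: vf_apply_fst[OF f vector_field_vertical_lift[OF X] i] vertical_lift_chart i)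
qed

lemma tangent_TM_decompose:
  assumes W: "W \<in> tangent_space TM u" and u: "u \<in> points TM"
  obtains X Y where "vector_field M X" "vector_field M Y" "W = HL X u + VL Y u"
proof -
  obtain i where i: "u \<in> T.dm i" using u by (auto simp: points_iff)
  then have p: "fst u \<in> dm i" by (simp add: tangent_bundle_dom)
  obtain X where X: "vector_field M X" "X (fst u) = coord_vector i (fst u) (fst (W i))"
    by (rule extend_tangent[OF coord_vector_tangent[OF p]])
  \<comment> \<open>The Christoffel term undoes the vertical component that \<open>HL X\<close>
    contributes.\<close>
  obtain Y where Y: "vector_field M Y"
    "Y (fst u) = coord_vector i (fst u) (snd (W i) + christoffel_form i (fst u) (fst (W i)) (snd u i))"
    by (rule extend_tangent[OF coord_vector_tangent[OF p]])
  have "HL X u + VL Y u \<in> tangent_space TM u"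
    by (intro T.tangent_add T.vector_field_tangent vector_field_horizontal_lift vector_field_vertical_lift X(1) Y(1))
  then have "W = HL X u + VL Y u"
    by (rule T.tangent_eqI[OF W _ i])
      (use p in \<open>simp add: horizontal_lift_chart vertical_lift_chart i X(2) Y(2) coord_vector_self prod_eq_iff\<close>)
  then show ?thesis using that X(1) Y(1) by blast
qed

lemma horizontal_lift_eq_0: "X (fst u) = 0 \<Longrightarrow> HL X u = 0"
  by (auto simp: horizontal_lift_def fun_eq_iff zero_prod_def)

lemma vertical_lift_eq_0: "X (fst u) = 0 \<Longrightarrow> VL X u = 0"
  by (auto simp: vertical_lift_def fun_eq_iff zero_prod_def)

end

section \<open>The quasi-statistical condition as a tensor identity\<close>

context manifold
begin

section \<open>Leibniz rules for derivations and brackets\<close>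

lemma dd_smooth_fun:
  "smooth_fun M f \<Longrightarrow> p \<in> dm i \<Longrightarrow>
    ((\<lambda>x. f (\<psi> i x)) has_derivative dd (\<lambda>x. f (\<psi> i x)) (\<phi> i p)) (at (\<phi> i p))"
  by (rule smooth_on_has_derivative[OF smooth_fun_smooth]) simp_all

lemma dd_vector_field:
  "vector_field M X \<Longrightarrow> p \<in> dm i \<Longrightarrow>
    ((\<lambda>x. X (\<psi> i x) i) has_derivative dd (\<lambda>x. X (\<psi> i x) i) (\<phi> i p)) (at (\<phi> i p))"
  by (rule smooth_on_has_derivative[OF vector_field_smooth]) simp_all

lemma vf_apply_add_field:
  assumes "smooth_fun M f" "vector_field M X" "vector_field M Y" "p \<in> points M"
  shows "vf_apply M (X + Y) f p = vf_apply M X f p + vf_apply M Y f p"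
proof -
  obtain i where i: "p \<in> dm i" using assms(4) by (auto simp: points_iff)
  have "linear (dd (\<lambda>x. f (\<psi> i x)) (\<phi> i p))"
    using dd_smooth_fun[OF assms(1) i] by (simp add: has_derivative_linear)
  then show ?thesis
    using i assms by (simp add: vf_apply_chart vector_field_tangent vector_field_add[OF assms(2,3)] linear_add
        tangent_add)
qed

lemma vf_apply_fscale_field:
  assumes "smooth_fun M f" "smooth_fun M g" "vector_field M X" "p \<in> points M"
  shows "vf_apply M (fscale g X) f p = g p * vf_apply M X f p"
proof -
  obtain i where i: "p \<in> dm i" using assms(4) by (auto simp: points_iff)
  have "linear (dd (\<lambda>x. f (\<psi> i x)) (\<phi> i p))"
    using dd_smooth_fun[OF assms(1) i] by (simp add: has_derivative_linear)
  then show ?thesis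
    using vf_apply_chart[where X = X and p = p, OF assms(1) vector_field_tangent[OF assms(3)] i]
      vf_apply_chart[where X = "fscale g X" and p = p, OF assms(1) vector_field_tangent[OF vector_field_fscale[OF assms(2,3)]] i]
    by (simp add: fscale_def linear_scale)
qed

lemma smooth_fun_add: "smooth_fun M f \<Longrightarrow> smooth_fun M g \<Longrightarrow> smooth_fun M (\<lambda>q. f q + g q)"
  by (auto simp: smooth_fun_def o_def intro!: smooth_on_add open_img)

lemma smooth_fun_mult: "smooth_fun M f \<Longrightarrow> smooth_fun M g \<Longrightarrow> smooth_fun M (\<lambda>q. f q * g q)"
  by (auto simp: smooth_fun_def o_def intro!: smooth_on_mult open_img)

lemma vf_apply_add_fun:
  assumes "smooth_fun M f" "smooth_fun M g" "vector_field M X" "p \<in> points M"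
  shows "vf_apply M X (\<lambda>q. f q + g q) p = vf_apply M X f p + vf_apply M X g p"
proof -
  obtain i where i: "p \<in> dm i" using assms(4) by (auto simp: points_iff)
  note v = vf_apply_chart[where X = X and p = p, OF _ vector_field_tangent[OF assms(3)] i]
  show ?thesis
    using has_derivative_add[OF dd_smooth_fun[OF assms(1) i] dd_smooth_fun[OF assms(2) i], THEN dd_eqI]
    by (simp add: v[OF assms(1)] v[OF assms(2)] v[OF smooth_fun_add[OF assms(1,2)]])
qed

lemma vf_apply_mult_fun:
  assumes "smooth_fun M f" "smooth_fun M g" "vector_field M X" "p \<in> points M"
  shows "vf_apply M X (\<lambda>q. f q * g q) p = f p * vf_apply M X g p + vf_apply M X f p * g p"
proof -
  obtain i where i: "p \<in> dm i" using assms(4) by (auto simp: points_iff)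
  note v = vf_apply_chart[where X = X and p = p, OF _ vector_field_tangent[OF assms(3)] i]
  show ?thesis
    using has_derivative_mult[OF dd_smooth_fun[OF assms(1) i] dd_smooth_fun[OF assms(2) i], THEN dd_eqI] i
    by (simp add: v[OF assms(1)] v[OF assms(2)] v[OF smooth_fun_mult[OF assms(1,2)]])
qed

lemma lie_bracket_commute: "lie_bracket M X Y p = - lie_bracket M Y X p"
  by (auto simp: lie_bracket_def fun_eq_iff)

lemma lie_bracket_add:
  assumes "vector_field M X" "vector_field M X'" "vector_field M Y"
  shows "lie_bracket M (X + X') Y p = lie_bracket M X Y p + lie_bracket M X' Y p"
proof
  fix i
  show "lie_bracket M (X + X') Y p i = (lie_bracket M X Y p + lie_bracket M X' Y p) i"
  proof (cases "p \<in> dm i")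
    case i: True
    have "linear (dd (\<lambda>x. Y (\<psi> i x) i) (\<phi> i p))"
      using dd_vector_field[OF assms(3) i] by (simp add: has_derivative_linear)
    then show ?thesis
      using has_derivative_add[OF dd_vector_field[OF assms(1) i] dd_vector_field[OF assms(2) i], THEN dd_eqI] i
      by (simp add: lie_bracket_chart linear_add)
  qed (simp add: lie_bracket_def)
qed

lemma lie_bracket_fscale:
  assumes f: "smooth_fun M f" and X: "vector_field M X" and Y: "vector_field M Y"
  shows "lie_bracket M (fscale f X) Y p
    = (\<lambda>i. f p *\<^sub>R lie_bracket M X Y p i) - (\<lambda>i. vf_apply M Y f p *\<^sub>R X p i)"
proof
  fix i
  show "lie_bracket M (fscale f X) Y p i
    = ((\<lambda>i. f p *\<^sub>R lie_bracket M X Y p i) - (\<lambda>i. vf_apply M Y f p *\<^sub>R X p i)) i"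
  proof (cases "p \<in> dm i")
    case i: True
    have "linear (dd (\<lambda>x. Y (\<psi> i x) i) (\<phi> i p))"
      using dd_vector_field[OF Y i] by (simp add: has_derivative_linear)
    moreover have "dd (\<lambda>x. fscale f X (\<psi> i x) i) (\<phi> i p) v
        = f p *\<^sub>R dd (\<lambda>x. X (\<psi> i x) i) (\<phi> i p) v + dd (\<lambda>x. f (\<psi> i x)) (\<phi> i p) v *\<^sub>R X p i" for v
      using has_derivative_scaleR[OF dd_smooth_fun[OF f i] dd_vector_field[OF X i], THEN dd_eqI] i
      by (simp add: fscale_def)
    ultimately show ?thesis
      using i vf_apply_chart[where X = Y and p = p, OF f vector_field_tangent[OF Y] i]
      by (simp add: lie_bracket_chart scaleR_right_diff_distrib) (simp add: fscale_def linear_scale)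
  next
    case False
    then show ?thesis using tangent_outside[OF vector_field_tangent[OF X]] by (simp add: lie_bracket_def)
  qed
qed

end

context affine_manifold
begin

text \<open>The exterior covariant derivative of \<open>k\<close>, viewed as a one-form with values in the cotangent
  bundle.\<close>

definition ext_deriv ::
  "('a, 'i, 'b) tensor02 \<Rightarrow> ('a, 'i, 'b) vfield \<Rightarrow> ('a, 'i, 'b) vfield \<Rightarrow> ('a, 'i, 'b) vfield \<Rightarrow> 'a \<Rightarrow> real" where
  "ext_deriv k A B C p = vf_apply M A (\<lambda>q. k q (B q) (C q)) p - vf_apply M B (\<lambda>q. k q (A q) (C q)) p
     - k p (B p) (D A C p) + k p (A p) (D B C p) - k p (lie_bracket M A B p) (C p)"

context
  fixes k assumes k: "tensor_field02 M k"
begin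

lemma tensor_add:
  assumes "p \<in> points M" "u \<in> tangent_space M p" "v \<in> tangent_space M p" "w \<in> tangent_space M p"
  shows "k p (u + v) w = k p u w + k p v w" "k p w (u + v) = k p w u + k p w v"
  using k assms unfolding tensor_field02_def by blast+

lemma tensor_scale:
  assumes "p \<in> points M" "u \<in> tangent_space M p" "w \<in> tangent_space M p"
  shows "k p (\<lambda>i. r *\<^sub>R u i) w = r * k p u w" "k p w (\<lambda>i. r *\<^sub>R u i) = r * k p w u"
  using k assms unfolding tensor_field02_def by blast+

lemmas tensor_linear = tensor_add tensor_scale

lemma tensor_diff:
  assumes p: "p \<in> points M" and u: "u \<in> tangent_space M p" and v: "v \<in> tangent_space M p"
    and w: "w \<in> tangent_space M p"
  shows "k p (u - v) w = k p u w - k p v w"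
proof -
  have "u - v = u + (\<lambda>i. (-1) *\<^sub>R v i)" by (auto simp: fun_eq_iff)
  then show ?thesis
    by (simp only: tensor_add(1)[OF p u tangent_scale[OF v] w] tensor_scale(1)[OF p v w])
qed

lemma tensor_zero:
  assumes p: "p \<in> points M" and w: "w \<in> tangent_space M p"
  shows "k p 0 w = 0" "k p w 0 = 0"
  using tensor_scale[OF p w w, of 0] by (simp_all add: zero_fun_def)

lemma smooth_fun_tensor:
  "vector_field M X \<Longrightarrow> vector_field M Y \<Longrightarrow> smooth_fun M (\<lambda>p. k p (X p) (Y p))"
  using k by (simp add: tensor_field02_def)

lemma quasi_statistical_expression:
  assumes A: "vector_field M A" and B: "vector_field M B" and C: "vector_field M C" and p: "p \<in> points M"
  shows "cov_deriv02 M D k A B C p - cov_deriv02 M D k B A C p + k p (torsion M D A B p) (C p)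
    = ext_deriv k A B C p"
proof -
  note t = vector_field_tangent[of _ p]
  have "k p (torsion M D A B p) (C p)
      = k p (D A B p) (C p) - k p (D B A p) (C p) - k p (lie_bracket M A B p) (C p)"
    using A B C by (simp add: torsion_def tensor_diff[OF p] tangent_diff t conn_vector_field
        vector_field_lie_bracket)
  then show ?thesis by (simp add: cov_deriv02_def ext_deriv_def)
qed

lemma ext_deriv_commute:
  assumes A: "vector_field M A" and B: "vector_field M B" and C: "vector_field M C" and p: "p \<in> points M"
  shows "ext_deriv k A B C p = - ext_deriv k B A C p"
proof -
  have "k p (lie_bracket M A B p) (C p) = k p (0 - lie_bracket M B A p) (C p)"
    by (subst lie_bracket_commute) simp
  also have "\<dots> = - k p (lie_bracket M B A p) (C p)"
    by (subst tensor_diff[OF p tangent_zero])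
      (simp_all add: tensor_zero[OF p] vector_field_tangent[of _ p] vector_field_lie_bracket A B C)
  finally show ?thesis by (simp add: ext_deriv_def)
qed

lemma vf_apply_tensor_add:
  assumes "vector_field M X" "vector_field M A" "vector_field M A'" "vector_field M C" and p: "p \<in> points M"
  shows "vf_apply M X (\<lambda>q. k q (A q + A' q) (C q)) p
      = vf_apply M X (\<lambda>q. k q (A q) (C q)) p + vf_apply M X (\<lambda>q. k q (A' q) (C q)) p"
    "vf_apply M X (\<lambda>q. k q (C q) (A q + A' q)) p
      = vf_apply M X (\<lambda>q. k q (C q) (A q)) p + vf_apply M X (\<lambda>q. k q (C q) (A' q)) p"
proof -
  have "vf_apply M X (\<lambda>q. k q (A q + A' q) (C q)) p = vf_apply M X (\<lambda>q. k q (A q) (C q) + k q (A' q) (C q)) p"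
    by (rule vf_apply_cong[OF _ p]) (simp add: tensor_linear vector_field_tangent assms)
  then show "vf_apply M X (\<lambda>q. k q (A q + A' q) (C q)) p
      = vf_apply M X (\<lambda>q. k q (A q) (C q)) p + vf_apply M X (\<lambda>q. k q (A' q) (C q)) p"
    by (simp add: vf_apply_add_fun smooth_fun_tensor assms)
  have "vf_apply M X (\<lambda>q. k q (C q) (A q + A' q)) p = vf_apply M X (\<lambda>q. k q (C q) (A q) + k q (C q) (A' q)) p"
    by (rule vf_apply_cong[OF _ p]) (simp add: tensor_linear vector_field_tangent assms)
  then show "vf_apply M X (\<lambda>q. k q (C q) (A q + A' q)) p
      = vf_apply M X (\<lambda>q. k q (C q) (A q)) p + vf_apply M X (\<lambda>q. k q (C q) (A' q)) p"
    by (simp add: vf_apply_add_fun smooth_fun_tensor assms)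
qed

lemma tensor_fscale:
  assumes "vector_field M A" "vector_field M C" "q \<in> points M"
  shows "k q (fscale f A q) (C q) = f q * k q (A q) (C q)" "k q (C q) (fscale f A q) = f q * k q (C q) (A q)"
  unfolding fscale_def using assms by (simp_all add: tensor_linear vector_field_tangent)

lemma vf_apply_tensor_fscale:
  assumes "vector_field M X" "vector_field M A" "vector_field M C" and p: "p \<in> points M" and f: "smooth_fun M f"
  shows "vf_apply M X (\<lambda>q. k q (fscale f A q) (C q)) p
      = f p * vf_apply M X (\<lambda>q. k q (A q) (C q)) p + vf_apply M X f p * k p (A p) (C p)"
    "vf_apply M X (\<lambda>q. k q (C q) (fscale f A q)) p
      = f p * vf_apply M X (\<lambda>q. k q (C q) (A q)) p + vf_apply M X f p * k p (C p) (A p)"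
proof -
  have "vf_apply M X (\<lambda>q. k q (fscale f A q) (C q)) p = vf_apply M X (\<lambda>q. f q * k q (A q) (C q)) p"
    by (rule vf_apply_cong[OF _ p]) (simp add: tensor_fscale assms)
  then show "vf_apply M X (\<lambda>q. k q (fscale f A q) (C q)) p
      = f p * vf_apply M X (\<lambda>q. k q (A q) (C q)) p + vf_apply M X f p * k p (A p) (C p)"
    by (simp add: vf_apply_mult_fun smooth_fun_tensor assms)
  have "vf_apply M X (\<lambda>q. k q (C q) (fscale f A q)) p = vf_apply M X (\<lambda>q. f q * k q (C q) (A q)) p"
    by (rule vf_apply_cong[OF _ p]) (simp add: tensor_fscale assms)
  then show "vf_apply M X (\<lambda>q. k q (C q) (fscale f A q)) p
      = f p * vf_apply M X (\<lambda>q. k q (C q) (A q)) p + vf_apply M X f p * k p (C p) (A p)"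
    by (simp add: vf_apply_mult_fun smooth_fun_tensor assms)
qed

text \<open>The factor \<open>f\<close> is differentiated along \<open>B\<close> in the second term
  and in the bracket; the two contributions B(f) k(A, C) cancel.\<close>

lemma tensorial_ext_deriv_1:
  assumes B: "vector_field M B" and C: "vector_field M C" and p: "p \<in> points M"
  shows "tensorial (\<lambda>A. ext_deriv k A B C p) p"
proof (rule tensorialI, goal_cases)
  note t = vector_field_tangent[of _ p]
  case (1 A A')
  then show ?case using B C p
    by (simp add: ext_deriv_def vf_apply_tensor_add vf_apply_add_field smooth_fun_tensor conn_add_left
        lie_bracket_add tensor_linear[OF p] t conn_vector_field vector_field_lie_bracket)
next
  note t = vector_field_tangent[of _ p]
  case (2 f A)
  have bracket: "k p (lie_bracket M (fscale f A) B p) (C p)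
      = f p * k p (lie_bracket M A B p) (C p) - vf_apply M B f p * k p (A p) (C p)"
    using 2 B C by (simp add: lie_bracket_fscale tensor_diff[OF p] tensor_linear[OF p] tangent_scale t
        vector_field_lie_bracket)
  show ?case using 2 B C p
    by (simp add: ext_deriv_def bracket vf_apply_tensor_fscale vf_apply_fscale_field smooth_fun_tensor
        conn_fscale_left tensor_fscale conn_vector_field algebra_simps)
qed

text \<open>Antisymmetry in the first two arguments transfers the previous case.\<close>

lemma tensorial_ext_deriv_2:
  assumes A: "vector_field M A" and C: "vector_field M C" and p: "p \<in> points M"
  shows "tensorial (\<lambda>B. ext_deriv k A B C p) p"
proof (rule tensorialI, goal_cases)
  case (1 B B')
  then show ?case
    using tensorial_add[OF tensorial_ext_deriv_1[OF A C p] 1]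
    by (simp add: ext_deriv_commute[OF A _ C p] vector_field_add)
next
  case (2 f B)
  then show ?case
    using tensorial_fscale[OF tensorial_ext_deriv_1[OF A C p] 2]
    by (simp add: ext_deriv_commute[OF A _ C p] vector_field_fscale)
qed

text \<open>Derivatives of \<open>f\<close> cancel in pairs: A(f) k(B, C) arises from
  differentiating the function k(B, C) along \<open>A\<close> and from the Leibniz rule for
  \<open>D A\<close>, and likewise with \<open>A\<close> and \<open>B\<close> exchanged.\<close>

lemma tensorial_ext_deriv_3:
  assumes A: "vector_field M A" and B: "vector_field M B" and p: "p \<in> points M"
  shows "tensorial (\<lambda>C. ext_deriv k A B C p) p"
proof (rule tensorialI, goal_cases)
  note t = vector_field_tangent[of _ p]
  case (1 C C')
  then show ?case using A B p
    by (simp add: ext_deriv_def vf_apply_tensor_add conn_add_right tensor_linear[OF p] t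
        conn_vector_field vector_field_lie_bracket)
next
  note t = vector_field_tangent[of _ p]
  case (2 f C)
  have conn: "k p (Y p) (D X (fscale f C) p) = f p * k p (Y p) (D X C p) + vf_apply M X f p * k p (Y p) (C p)"
    if "vector_field M X" "vector_field M Y" for X Y
    using that 2 by (simp add: conn_fscale_right) (simp add: fscale_def tensor_linear[OF p] tangent_scale t conn_vector_field)
  have bracket: "k p (lie_bracket M A B p) (fscale f C p) = f p * k p (lie_bracket M A B p) (C p)"
    using tensor_fscale(2)[OF 2(2) vector_field_lie_bracket[OF A B] p] .
  show ?case using 2 A B p
    by (simp add: ext_deriv_def conn bracket vf_apply_tensor_fscale algebra_simps)
qed

lemma quasi_statistical_iff:
  "nondegenerate02 M k \<Longrightarrow> quasi_statistical_manifold M k D \<longleftrightarrow>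
     (\<forall>A B C. vector_field M A \<longrightarrow> vector_field M B \<longrightarrow> vector_field M C \<longrightarrow>
        (\<forall>p\<in>points M. ext_deriv k A B C p = 0))"
  using smooth_manifold conn k
  by (simp add: quasi_statistical_manifold_def quasi_statistical_expression)

end

end

section \<open>The horizontal lift of a quasi-statistical structure\<close>

locale lifted_structure = affine_manifold M D
  for M :: "('a, 'i, 'b::euclidean_space) atlas" and D :: "('a, 'i, 'b) conn" +
  fixes h :: "('a, 'i, 'b) tensor02"
    and hH :: "('a \<times> ('i \<Rightarrow> 'b), 'i, 'b \<times> 'b) tensor02"
    and D' :: "('a \<times> ('i \<Rightarrow> 'b), 'i, 'b \<times> 'b) conn"
  assumes quasi: "quasi_statistical_manifold M h D"
    and flat: "flat_connection M D"
    and hH: "horizontal_lift02 M D h hH"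
    and conn': "affine_connection (tangent_bundle M) D'"
    and D'_HH: "\<And>X Y. vector_field M X \<Longrightarrow> vector_field M Y \<Longrightarrow>
      D' (horizontal_lift M D X) (horizontal_lift M D Y) = horizontal_lift M D (D X Y)"
    and D'_HV: "\<And>X Y. vector_field M X \<Longrightarrow> vector_field M Y \<Longrightarrow>
      D' (horizontal_lift M D X) (vertical_lift M Y) = vertical_lift M (D X Y)"
    and D'_VH: "\<And>X Y. vector_field M X \<Longrightarrow> vector_field M Y \<Longrightarrow>
      D' (vertical_lift M X) (horizontal_lift M D Y) = 0"
    and D'_VV: "\<And>X Y. vector_field M X \<Longrightarrow> vector_field M Y \<Longrightarrow>
      D' (vertical_lift M X) (vertical_lift M Y) = 0"

sublocale lifted_structure \<subseteq> L: affine_manifold "tangent_bundle M" D'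
  by unfold_locales (rule conn')

context lifted_structure
begin

lemma h: "tensor_field02 M h" and nondegenerate_h: "nondegenerate02 M h"
  using quasi by (simp_all add: quasi_statistical_manifold_def)

lemma tensor_hH: "tensor_field02 TM hH"
  using hH by (simp add: horizontal_lift02_def)

lemma ext_deriv_h:
  "vector_field M X \<Longrightarrow> vector_field M Y \<Longrightarrow> vector_field M Z \<Longrightarrow> p \<in> points M \<Longrightarrow> ext_deriv h X Y Z p = 0"
  using quasi quasi_statistical_iff[OF h nondegenerate_h] by blast

lemma hH_lifts:
  assumes "vector_field M X" "vector_field M Y" "u \<in> points TM"
  shows "hH u (HL X u) (HL Y u) = 0" "hH u (VL X u) (VL Y u) = 0"
    "hH u (HL X u) (VL Y u) = h (fst u) (X (fst u)) (Y (fst u))"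
    "hH u (VL X u) (HL Y u) = h (fst u) (X (fst u)) (Y (fst u))"
  using hH assms unfolding horizontal_lift02_def by blast+

lemmas lift_vf = vector_field_horizontal_lift vector_field_vertical_lift

text \<open>Paired with vertical lifts \<open>W\<close> reveals its horizontal part, and with
  horizontal lifts its vertical part, so each kernel of \<open>hH\<close> reduces to the
  corresponding kernel of \<open>h\<close>.\<close>

lemma nondegenerate_hH: "nondegenerate02 TM hH"
  unfolding nondegenerate02_def
proof (intro ballI)
  fix u W assume u: "u \<in> points TM" and W: "W \<in> tangent_space TM u"
  obtain X Y where XY: "vector_field M X" "vector_field M Y" and W': "W = HL X u + VL Y u"
    by (rule tangent_TM_decompose[OF W u])
  let ?p = "fst u"
  have p: "?p \<in> points M" using u by (simp add: tangent_bundle_points)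
  note lin = L.tensor_linear[OF tensor_hH u] T.vector_field_tangent lift_vf XY
  have vals: "hH u W (VL Z u) = h ?p (X ?p) (Z ?p)" "hH u W (HL Z u) = h ?p (Y ?p) (Z ?p)"
    "hH u (VL Z u) W = h ?p (Z ?p) (X ?p)" "hH u (HL Z u) W = h ?p (Z ?p) (Y ?p)"
    if "vector_field M Z" for Z
    unfolding W' using that by (simp_all add: lin hH_lifts u)
  have left: "A ?p = 0" if A: "vector_field M A" and 0: "\<And>Z. vector_field M Z \<Longrightarrow> h ?p (A ?p) (Z ?p) = 0" for A
  proof -
    have "h ?p (A ?p) w = 0" if "w \<in> tangent_space M ?p" for w
      using extend_tangent[OF that] 0 by metis
    then show ?thesis using nondegenerate_h p vector_field_tangent[OF A] unfolding nondegenerate02_def by blast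
  qed
  have right: "A ?p = 0" if A: "vector_field M A" and 0: "\<And>Z. vector_field M Z \<Longrightarrow> h ?p (Z ?p) (A ?p) = 0" for A
  proof -
    have "h ?p w (A ?p) = 0" if "w \<in> tangent_space M ?p" for w
      using extend_tangent[OF that] 0 by metis
    then show ?thesis using nondegenerate_h p vector_field_tangent[OF A] unfolding nondegenerate02_def by blast
  qed
  have zero: "W = 0" if "X ?p = 0" "Y ?p = 0"
    using that by (simp add: W' horizontal_lift_eq_0 vertical_lift_eq_0)
  show "((\<forall>w\<in>tangent_space TM u. hH u W w = 0) \<longrightarrow> W = 0) \<and> ((\<forall>w\<in>tangent_space TM u. hH u w W = 0) \<longrightarrow> W = 0)"
  proof (intro conjI impI)
    assume 0: "\<forall>w\<in>tangent_space TM u. hH u W w = 0"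
    show "W = 0"
      using zero left[OF XY(1)] left[OF XY(2)] vals(1,2) 0 T.vector_field_tangent lift_vf by metis
  next
    assume 0: "\<forall>w\<in>tangent_space TM u. hH u w W = 0"
    show "W = 0"
      using zero right[OF XY(1)] right[OF XY(2)] vals(3,4) 0 T.vector_field_tangent lift_vf by metis
  qed
qed

lemma vf_apply_hH:
  assumes "vector_field M X" "vector_field M Y" "u \<in> points TM"
  shows "vf_apply TM W (\<lambda>q. hH q (HL X q) (HL Y q)) u = vf_apply TM W (\<lambda>q. 0) u"
    "vf_apply TM W (\<lambda>q. hH q (VL X q) (VL Y q)) u = vf_apply TM W (\<lambda>q. 0) u"
    "vf_apply TM W (\<lambda>q. hH q (HL X q) (VL Y q)) u = vf_apply TM W (\<lambda>q. h (fst q) (X (fst q)) (Y (fst q))) u"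
    "vf_apply TM W (\<lambda>q. hH q (VL X q) (HL Y q)) u = vf_apply TM W (\<lambda>q. h (fst q) (X (fst q)) (Y (fst q))) u"
  by (rule T.vf_apply_cong[OF _ assms(3)], simp add: hH_lifts assms)+

lemma vf_apply_zero: "vf_apply N W (\<lambda>q. 0) u = 0"
  by (simp add: vf_apply_def o_def)

text \<open>Terms survive only where \<open>hH\<close> pairs a horizontal with a vertical lift. On
  (H, H, H) nothing is left, as the bracket is horizontal; on (H, H, V) all five terms survive and
  form the condition on \<open>M\<close>. On (H, V, H) the terms that differentiate along the
  vertical field vanish, and the bracket supplies the term h(D X Y, Z) of the covariant
  derivative.\<close>

lemma ext_deriv_lifts:
  assumes X: "vector_field M X" and Y: "vector_field M Y" and Z: "vector_field M Z" and u: "u \<in> points TM"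
  shows "L.ext_deriv hH (HL X) (HL Y) (HL Z) u = 0"
    and "L.ext_deriv hH (HL X) (HL Y) (VL Z) u = 0"
    and "L.ext_deriv hH (HL X) (VL Y) (HL Z) u = cov_deriv02 M D h X Y Z (fst u)"
    and "L.ext_deriv hH (HL X) (VL Y) (VL Z) u = 0"
    and "L.ext_deriv hH (VL X) (VL Y) (HL Z) u = 0"
    and "L.ext_deriv hH (VL X) (VL Y) (VL Z) u = 0"
proof -
  have p: "fst u \<in> points M" using u by (simp add: tangent_bundle_points)
  have f: "smooth_fun M (\<lambda>p. h p (A p) (B p))" if "vector_field M A" "vector_field M B" for A B
    using smooth_fun_tensor[OF h that] .
  have vfH: "vf_apply TM (HL A) (\<lambda>q. h (fst q) (B (fst q)) (C (fst q))) u
      = vf_apply M A (\<lambda>q. h q (B q) (C q)) (fst u)"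
    "vf_apply TM (VL A) (\<lambda>q. h (fst q) (B (fst q)) (C (fst q))) u = 0"
    if "vector_field M A" "vector_field M B" "vector_field M C" for A B C
    using vf_apply_horizontal_lift[OF f[OF that(2,3)] that(1) u]
      vf_apply_vertical_lift[OF f[OF that(2,3)] that(1) u] by simp_all
  have zero: "hH u 0 (HL A u) = 0" "hH u 0 (VL A u) = 0" "hH u (HL A u) 0 = 0" "hH u (VL A u) 0 = 0"
    if "vector_field M A" for A
    using that by (simp_all add: L.tensor_zero[OF tensor_hH u] T.vector_field_tangent lift_vf)
  note S = L.ext_deriv_def vf_apply_hH[OF _ _ u] vf_apply_zero vfH hH_lifts[OF _ _ u] zero
    lie_bracket_HH[OF flat] lie_bracket_HV lie_bracket_VV D'_HH D'_HV D'_VH D'_VV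
    conn_vector_field vector_field_lie_bracket X Y Z
  show "L.ext_deriv hH (HL X) (HL Y) (HL Z) u = 0" by (simp add: S)
  show "L.ext_deriv hH (HL X) (HL Y) (VL Z) u = 0"
    using ext_deriv_h[OF X Y Z p] by (simp add: S ext_deriv_def)
  show "L.ext_deriv hH (HL X) (VL Y) (HL Z) u = cov_deriv02 M D h X Y Z (fst u)"
    by (simp add: S cov_deriv02_def)
  show "L.ext_deriv hH (HL X) (VL Y) (VL Z) u = 0" by (simp add: S)
  show "L.ext_deriv hH (VL X) (VL Y) (HL Z) u = 0" by (simp add: S)
  show "L.ext_deriv hH (VL X) (VL Y) (VL Z) u = 0" by (simp add: S)
qed

text \<open>By tensoriality \<open>A\<close> may be replaced by a sum of lifts with the same value
  at \<open>u\<close>.\<close>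

lemma tensorial_lifts_eq_0:
  assumes T: "T.tensorial T u" and A: "vector_field TM A" and u: "u \<in> points TM"
    and H: "\<And>X. vector_field M X \<Longrightarrow> T (HL X) = 0" and V: "\<And>X. vector_field M X \<Longrightarrow> T (VL X) = 0"
  shows "T A = (0 :: real)"
proof -
  obtain X Y where XY: "vector_field M X" "vector_field M Y" "A u = HL X u + VL Y u"
    by (rule tangent_TM_decompose[OF T.vector_field_tangent[OF A] u])
  have "T A = T (HL X + VL Y)"
    by (rule T.tensorial_cong[OF T A _ u]) (simp_all add: XY T.vector_field_add lift_vf)
  also have "\<dots> = 0" using XY H V by (simp add: T.tensorial_add[OF T] lift_vf)
  finally show ?thesis .
qed

lemma quasi_statistical_lift_iff_parallel:
  "quasi_statistical_manifold TM hH D' \<longleftrightarrow> parallel02 M D h"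
  unfolding L.quasi_statistical_iff[OF tensor_hH nondegenerate_hH]
proof
  assume 0: "\<forall>A B C. vector_field TM A \<longrightarrow> vector_field TM B \<longrightarrow> vector_field TM C \<longrightarrow>
    (\<forall>u\<in>points TM. L.ext_deriv hH A B C u = 0)"
  show "parallel02 M D h"
    unfolding parallel02_def
  proof (intro allI impI ballI)
    fix X Y Z p
    assume XYZ: "vector_field M X" "vector_field M Y" "vector_field M Z" and p: "p \<in> points M"
    \<comment> \<open>The zero vector is a convenient point of \<open>TM\<close> over
      \<open>p\<close>; the value on lifts depends on the base point only.\<close>
    have u: "(p, 0) \<in> points TM" using p tangent_zero by (simp add: tangent_bundle_points)
    show "cov_deriv02 M D h X Y Z p = 0"
      using ext_deriv_lifts(3)[OF XYZ u] 0 XYZ u by (simp add: lift_vf)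
  qed
next
  assume par: "parallel02 M D h"
  show "\<forall>A B C. vector_field TM A \<longrightarrow> vector_field TM B \<longrightarrow> vector_field TM C \<longrightarrow>
    (\<forall>u\<in>points TM. L.ext_deriv hH A B C u = 0)"
  proof (intro allI impI ballI)
    fix A B C u
    assume A: "vector_field TM A" and B: "vector_field TM B" and C: "vector_field TM C"
      and u: "u \<in> points TM"
    note T1 = L.tensorial_ext_deriv_1[OF tensor_hH _ _ u]
      and T2 = L.tensorial_ext_deriv_2[OF tensor_hH _ _ u]
      and T3 = L.tensorial_ext_deriv_3[OF tensor_hH _ _ u]
    have HV: "L.ext_deriv hH (HL X) (VL Y) (HL Z) u = 0"
      if "vector_field M X" "vector_field M Y" "vector_field M Z" for X Y Z
      using ext_deriv_lifts(3)[OF that u] par that u by (simp add: parallel02_def tangent_bundle_points)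
    \<comment> \<open>Lifts are replaced by arbitrary fields one argument at a time, starting with
      the third.\<close>
    have HHC: "L.ext_deriv hH (HL X) (HL Y) C u = 0" if "vector_field M X" "vector_field M Y" for X Y
      by (rule tensorial_lifts_eq_0[OF T3 C u]) (simp_all add: that lift_vf ext_deriv_lifts u)
    have HVC: "L.ext_deriv hH (HL X) (VL Y) C u = 0" if "vector_field M X" "vector_field M Y" for X Y
      by (rule tensorial_lifts_eq_0[OF T3 C u]) (simp_all add: that lift_vf ext_deriv_lifts(4) HV u)
    have VVC: "L.ext_deriv hH (VL X) (VL Y) C u = 0" if "vector_field M X" "vector_field M Y" for X Y
      by (rule tensorial_lifts_eq_0[OF T3 C u]) (simp_all add: that lift_vf ext_deriv_lifts u)
    have VHC: "L.ext_deriv hH (VL X) (HL Y) C u = 0" if "vector_field M X" "vector_field M Y" for X Y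
      using that by (subst L.ext_deriv_commute[OF tensor_hH _ _ C u]) (simp_all add: HVC lift_vf)
    have HBC: "L.ext_deriv hH (HL X) B C u = 0" if "vector_field M X" for X
      by (rule tensorial_lifts_eq_0[OF T2 B u]) (simp_all add: that lift_vf HHC HVC C)
    have VBC: "L.ext_deriv hH (VL X) B C u = 0" if "vector_field M X" for X
      by (rule tensorial_lifts_eq_0[OF T2 B u]) (simp_all add: that lift_vf VHC VVC C)
    show "L.ext_deriv hH A B C u = 0"
      by (rule tensorial_lifts_eq_0[OF T1 A u]) (simp_all add: B C HBC VBC)
  qed
qed

end

theorem theorem4p13:
  fixes M :: "('a, 'i, 'b::euclidean_space) atlas"
    and h :: "('a, 'i, 'b) tensor02"
    and nabla :: "('a, 'i, 'b) conn"
    and hH :: "('a \<times> ('i \<Rightarrow> 'b), 'i, 'b \<times> 'b) tensor02"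
    and nabla' :: "('a \<times> ('i \<Rightarrow> 'b), 'i, 'b \<times> 'b) conn"
  assumes "quasi_statistical_manifold M h nabla"
    and "flat_connection M nabla"
    and "horizontal_lift02 M nabla h hH"
    and "affine_connection (tangent_bundle M) nabla'"
    and "\<And>X Y. vector_field M X \<Longrightarrow> vector_field M Y \<Longrightarrow>
           nabla' (horizontal_lift M nabla X) (horizontal_lift M nabla Y)
             = horizontal_lift M nabla (nabla X Y)"
    and "\<And>X Y. vector_field M X \<Longrightarrow> vector_field M Y \<Longrightarrow>
           nabla' (horizontal_lift M nabla X) (vertical_lift M Y) = vertical_lift M (nabla X Y)"
    and "\<And>X Y. vector_field M X \<Longrightarrow> vector_field M Y \<Longrightarrow>
           nabla' (vertical_lift M X) (horizontal_lift M nabla Y) = 0"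
    and "\<And>X Y. vector_field M X \<Longrightarrow> vector_field M Y \<Longrightarrow>
           nabla' (vertical_lift M X) (vertical_lift M Y) = 0"
  shows "quasi_statistical_manifold (tangent_bundle M) hH nabla' \<longleftrightarrow> parallel02 M nabla h"
proof -
  interpret lifted_structure M nabla h hH nabla'
    using assms by unfold_locales (simp_all add: quasi_statistical_manifold_def)
  show ?thesis by (rule quasi_statistical_lift_iff_parallel)
qed

end
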